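(* Let $(a,b,c)\in\mathcal{A}=\big\{(a,b,c)\in\frac12\mathbb{Z}\times\frac12\mathbb{Z}\times\mathbb{Z} : a+b\in\mathbb{Z}\big\}$. Then $(a,b,c)$ is equal to $\big(A(P),\frac12B(P),C(P)\big)$ for some (not necessarily convex) lattice polygon $P$ if and only if $c=1$ and $a+1\ge b\ge\frac32$.
   Context: A lattice polygon $P$ is a (not necessarily convex) polygon in $\mathbb{R}^2$, i.e. the closed region bounded by a simple (non-self-intersecting) closed polygonal curve, all of whose vertices lie in $\mathbb{Z}^2$. $A(P)$ is the area of $P$, and $B(P)=|\partial P\cap\mathbb{Z}^2|$ is the number of lattice points on the boundary of $P$. $C(P)$ is the rotation number around the origin of the sequence of outward normal vectors $n_1,\dots,n_d$ to the successive sides of $P$, taken in counterclockwise order along the boundary, that is, $\frac1{2\pi}\sum_{i=1}^d\theta_i$ with $\theta_i\in(-\pi,\pi)$ the signed angle (counterclockwise positive) from $n_i$ to $n_{i+1}$ and $n_{d+1}=n_1$. For every lattice polygon one has $C(P)=1$. *)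

theory Defs
  imports "HOL-Complex_Analysis.Complex_Analysis"
begin

text \<open>
  The Euclidean plane is represented by the type of complex numbers, which carries the
  standard inner product and Lebesgue measure of the plane together with \<^const>\<open>Arg\<close>
  and \<^const>\<open>winding_number\<close>.
\<close>

definition lattice_points :: "complex set" where
  "lattice_points = {z. Re z \<in> \<int> \<and> Im z \<in> \<int>}"

definition triples :: "(real \<times> real \<times> real) set" where
  "triples = {(a, b, c). 2 * a \<in> \<int> \<and> 2 * b \<in> \<int> \<and> c \<in> \<int> \<and> a + b \<in> \<int>}"

text \<open>The empty and one-element lists only get dummy constant paths, which are never simple.\<close>

fun polygonal_path :: "complex list \<Rightarrow> real \<Rightarrow> complex" where
  "polygonal_path [] = linepath 0 0"
| "polygonal_path [u] = linepath u u"
| "polygonal_path [u, v] = linepath u v"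
| "polygonal_path (u # v # w # vs) = linepath u v +++ polygonal_path (v # w # vs)"

definition closed_polygonal_path :: "complex list \<Rightarrow> real \<Rightarrow> complex" where
  "closed_polygonal_path vs = polygonal_path (vs @ [hd vs])"

text \<open>
  Consecutive collinear sides are allowed: a boundary point at which the boundary does not
  turn may or may not be listed as a vertex. This neither changes the class of lattice
  polygons nor the rotation number, since the angle at such a vertex is 0.
\<close>

definition polygon_vertices :: "complex set \<Rightarrow> complex list \<Rightarrow> bool" where
  "polygon_vertices P vs \<longleftrightarrow>
     length vs \<ge> 3 \<and> set vs \<subseteq> lattice_points \<and>
     simple_path (closed_polygonal_path vs) \<and>
     P = path_image (closed_polygonal_path vs) \<union> inside (path_image (closed_polygonal_path vs))"

definition lattice_polygon :: "complex set \<Rightarrow> bool" where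
  "lattice_polygon P \<longleftrightarrow> (\<exists>vs. polygon_vertices P vs)"

definition polygon_area :: "complex set \<Rightarrow> real" where
  "polygon_area P = measure lebesgue P"

definition boundary_count :: "complex set \<Rightarrow> nat" where
  "boundary_count P = card (frontier P \<inter> lattice_points)"

definition ccw_vertices :: "complex set \<Rightarrow> complex list \<Rightarrow> bool" where
  "ccw_vertices P vs \<longleftrightarrow>
     polygon_vertices P vs \<and>
     (\<forall>z \<in> inside (path_image (closed_polygonal_path vs)).
        winding_number (closed_polygonal_path vs) z = 1)"

text \<open>
  The unit outward normal of \<open>P\<close> along its side from \<open>u\<close> to \<open>v\<close>. The length of
  the normal is irrelevant for the angles below; fixing it makes the normal unique.
\<close>

definition outward_normal :: "complex set \<Rightarrow> complex \<Rightarrow> complex \<Rightarrow> complex" where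
  "outward_normal P u v =
     (THE n. norm n = 1 \<and> n \<bullet> (v - u) = 0 \<and>
        (\<forall>x \<in> open_segment u v. \<forall>\<^sub>F t in at_right 0. x + t *\<^sub>R n \<notin> P))"

definition side_normal :: "complex set \<Rightarrow> complex list \<Rightarrow> nat \<Rightarrow> complex" where
  "side_normal P vs i =
     outward_normal P (vs ! (i mod length vs)) (vs ! (Suc i mod length vs))"

text \<open>
  For nonzero \<open>m\<close> and \<open>n\<close>, \<open>Arg (n / m)\<close> is the signed angle from \<open>m\<close> to
  \<open>n\<close>, positive for counterclockwise turns. \<^const>\<open>Arg\<close> takes values in the
  interval from \<open>-pi\<close> (excluded) to \<open>pi\<close> (included); the value \<open>pi\<close> would
  require two successive sides that overlap, which cannot happen on a simple closed path.
\<close>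

definition normals_rotation :: "complex set \<Rightarrow> complex list \<Rightarrow> real" where
  "normals_rotation P vs =
     (\<Sum>i < length vs. Arg (side_normal P vs (Suc i) / side_normal P vs i)) / (2 * pi)"

text \<open>
  The value does not depend on the chosen counterclockwise list of vertices: two such lists
  differ by a cyclic shift and by the flat vertices listed.
\<close>

definition rotation_number :: "complex set \<Rightarrow> real" where
  "rotation_number P = normals_rotation P (SOME vs. ccw_vertices P vs)"

end

theory Submission
  imports Defs
begin

text \<open>
  Everything rests on the signed angle \<open>view_angle q u v\<close> under which a segment is seen from a
  point \<open>q\<close>, and on its sum \<open>total_angle q\<close> over the sides of a simple polygon \<open>P\<close> traversed
  counterclockwise. Off the boundary this sum is \<open>2 * pi\<close> times the winding number, so it is
  \<open>2 * pi\<close> inside and 0 outside. On the boundary it is the interior angle of \<open>P\<close>: near a boundary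
  point the sum takes only the values 0 and \<open>2 * pi\<close>, and both occur, on the two rays of the
  bisector; the limits along these rays then leave only one possible value (\<open>boundary_angle\<close>).
  The same argument shows that the inside lies to the left of each side, so that the outward
  normals are the sides turned clockwise by a right angle and the rotation number is the sum of
  the exterior angles divided by \<open>2 * pi\<close>.

  That the exterior angles sum to \<open>2 * pi\<close> is proved as in Hopf's theorem on turning tangents,
  but with finitely many directions: one follows the direction from a vertex \<open>w i\<close> to a vertex
  \<open>w j\<close> over the triangle of index pairs \<open>i < j\<close>. The directions between two disjoint sides stay
  in a half plane, so the rotation around an elementary square of index pairs vanishes, and the
  rotation along the diagonal (the exterior angles) equals the rotation along the two legs and a
  detour around the pair \<open>(0, n)\<close>, which has no direction because \<open>w n = w 0\<close>. Each
  leg contributes the total angle at \<open>w 0\<close>, which is known to be the interior angle there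
  (\<open>sum_turn_eq\<close>, \<open>sum_turn\<close>).

  Pick's formula \<open>A = I + B / 2 - 1\<close>, with \<open>I\<close> and \<open>B\<close> the numbers of interior and of boundary
  lattice points, follows by comparing the area with the sum of \<open>total_angle\<close> over the lattice.
  Reflection in the midpoint of a side preserves the lattice and reverses the angle under which
  the side is seen. Hence the sum over lattice points \<open>p\<close> of
  \<open>total_angle (p + z) + total_angle (p - z)\<close> does not depend on \<open>z\<close>
  (\<open>lattice_sum_shift_invariant\<close>); integrating it over \<open>z\<close> in a unit square gives \<open>4 * pi * A\<close>,
  while for \<open>z = 0\<close> it is twice the sum of the total angles at the lattice points. That sum is
  \<open>2 * pi * I + pi * B - 2 * pi\<close>, the last term being the sum of the exterior angles.

  The conditions on \<open>(a, b, c)\<close> now say that \<open>B \<ge> 3\<close>, which holds because a polygon has at least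
  three vertices, that \<open>I \<ge> 0\<close>, and that the rotation number is 1. Conversely, every pair of
  numbers \<open>I \<ge> 0\<close> and \<open>B \<ge> 3\<close> is attained by a triangle or quadrilateral between the lines
  \<open>Im z = - 1\<close> and \<open>Im z = 1\<close>, whose interior lattice points all lie on the real axis.
\<close>

section \<open>The angle under which a segment is seen\<close>

lemma convex_avoiding_0_half_plane:
  assumes "convex K" "closed K" "0 \<notin> K"
  obtains c where "\<And>z. z \<in> K \<Longrightarrow> Re (z * c) > 0"
proof -
  obtain a b where ab: "a \<noteq> 0" "0 < b" "\<forall>x\<in>K. inner a x > b"
    using separating_hyperplane_closed_0[OF assms] by blast
  show ?thesis
  proof
    fix z assume "z \<in> K"
    then show "Re (z * cnj a) > 0"
      using ab(2,3) by (force simp: inner_complex_def algebra_simps)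
  qed
qed

lemma Arg_divide_Re_pos:
  assumes "Re x > 0" "Re y > 0"
  shows "Arg (y / x) = Arg y - Arg x"
proof -
  have "x \<noteq> 0" "y \<noteq> 0" using assms by auto
  moreover have "\<bar>Arg x\<bar> < pi/2" "\<bar>Arg y\<bar> < pi/2" using assms Arg_Re_pos[of x] Arg_Re_pos[of y] by auto
  then have "- pi < Arg y - Arg x" "Arg y - Arg x < pi" by linarith+
  ultimately show ?thesis by (simp add: Arg_divide')
qed

lemma Arg_divide_half_plane:
  assumes "Re (x * c) > 0" "Re (y * c) > 0"
  shows "Arg (y / x) = Arg (y * c) - Arg (x * c)"
proof -
  have "c \<noteq> 0" using assms by auto
  then have "y / x = (y * c) / (x * c)" by simp
  then show ?thesis using Arg_divide_Re_pos[OF assms] by simp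
qed

text \<open>
  In a half plane avoiding 0 there is a continuous branch of the argument, so signed angles add up
  without multiples of \<open>2 * pi\<close>. All additivity of angles below comes from this.
\<close>

lemma Arg_chain_convex:
  assumes "convex K" "closed K" "0 \<notin> K" "x \<in> K" "y \<in> K" "z \<in> K"
  shows "Arg (y / x) + Arg (z / y) = Arg (z / x)"
proof -
  obtain c where "\<And>z. z \<in> K \<Longrightarrow> Re (z * c) > 0"
    using convex_avoiding_0_half_plane assms(1-3) by blast
  then have c: "Arg (b / a) = Arg (b * c) - Arg (a * c)" if "a \<in> K" "b \<in> K" for a b
    using that by (intro Arg_divide_half_plane)
  show ?thesis using c[OF assms(4,5)] c[OF assms(5,6)] c[OF assms(4,6)] by linarith
qed

text \<open>
  Across the interior of the segment the angle jumps between \<open>pi\<close> and \<open>- pi\<close>. The value 0 on the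
  segment is the mean of the two; it makes the reflection law below hold at every point and lets
  the sum over all sides of a polygon be evaluated on the boundary by leaving out the sides
  through the point.
\<close>

definition view_angle :: "complex \<Rightarrow> complex \<Rightarrow> complex \<Rightarrow> real" where
  "view_angle q u v = (if q \<in> closed_segment u v then 0 else Arg ((v - q) / (u - q)))"

lemma translate_segment: "z \<in> closed_segment u v \<longleftrightarrow> z - q \<in> closed_segment (u - q) (v - q)"
  using closed_segment_translation_eq[of "-q" z u v] by simp

text \<open>
  A ratio \<open>r \<le> 0\<close> would put \<open>q\<close> between \<open>u\<close> and \<open>v\<close>, at the weights \<open>- r / (1 - r)\<close>
  and \<open>1 / (1 - r)\<close>.
\<close>

lemma ratio_notin_nonpos_Reals:
  fixes q :: complex
  assumes "q \<notin> closed_segment u v"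
  shows "(v - q) / (u - q) \<notin> \<real>\<^sub>\<le>\<^sub>0"
proof
  assume "(v - q) / (u - q) \<in> \<real>\<^sub>\<le>\<^sub>0"
  moreover have "u \<noteq> q" using assms by auto
  ultimately obtain r where r: "r \<le> 0" "v - q = of_real r * (u - q)"
    by (auto elim!: nonpos_Reals_cases simp: field_simps)
  define t where "t = 1 / (1 - r)"
  have t: "0 \<le> t" "t \<le> 1" "t * (1 - r) = 1" using r(1) by (auto simp: t_def field_simps)
  have tr: "1 - t = - t * r" using t(3) by (simp add: algebra_simps)
  have "(1 - t) *\<^sub>R u + t *\<^sub>R v - q = (1 - t) *\<^sub>R (u - q) + t *\<^sub>R (v - q)"
    by (simp add: algebra_simps scaleR_conv_of_real)
  also have "\<dots> = 0" by (simp add: r(2) tr scaleR_conv_of_real)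
  finally have "q = (1 - t) *\<^sub>R u + t *\<^sub>R v" by simp
  then show False using assms t by (auto simp: closed_segment_def)
qed

lemma view_angle_split:
  assumes "p \<in> closed_segment u v" "q \<notin> closed_segment u v"
  shows "view_angle q u v = view_angle q u p + view_angle q p v"
proof -
  let ?K = "closed_segment (u - q) (v - q)"
  have "0 \<notin> ?K" using assms(2) translate_segment[of q u v q] by simp
  moreover have "p - q \<in> ?K" using assms(1) translate_segment by blast
  ultimately have "Arg ((p - q) / (u - q)) + Arg ((v - q) / (p - q)) = Arg ((v - q) / (u - q))"
    by (intro Arg_chain_convex[of ?K]) auto
  moreover have "q \<notin> closed_segment u p" "q \<notin> closed_segment p v"
    using assms subset_closed_segment[of u p u v] subset_closed_segment[of p v u v] by auto
  ultimately show ?thesis using assms by (simp add: view_angle_def)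
qed

lemma Arg_inverse_not_nonpos:
  assumes "z \<notin> \<real>\<^sub>\<le>\<^sub>0"
  shows "Arg (inverse z) = - Arg z"
proof (cases "z \<in> \<real>")
  case True
  then have "Re z > 0" using assms by (auto simp: complex_nonpos_Reals_iff complex_is_Real_iff)
  then have "Arg z = 0" using True by (simp add: Arg_eq_0)
  then show ?thesis by (simp add: Arg_inverse)
qed (simp add: Arg_inverse)

lemma view_angle_swap: "view_angle q v u = - view_angle q u v"
proof (cases "q \<in> closed_segment u v")
  case True
  then show ?thesis by (simp add: view_angle_def closed_segment_commute)
next
  case False
  have "Arg (inverse ((v - q) / (u - q))) = - Arg ((v - q) / (u - q))"
    by (rule Arg_inverse_not_nonpos[OF ratio_notin_nonpos_Reals[OF False]])
  then show ?thesis using False by (simp add: view_angle_def closed_segment_commute)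
qed

text \<open>
  The half turn about the midpoint of the segment preserves signed angles but exchanges the two
  endpoints.
\<close>

lemma view_angle_point_reflection: "view_angle (u + v - q) u v = - view_angle q u v"
proof -
  have "(u + v - q \<in> closed_segment u v) = (q \<in> closed_segment v u)"
  proof -
    have "(q \<in> closed_segment v u) \<longleftrightarrow> (u + v - q \<in> (\<lambda>x. u + v - x) ` closed_segment v u)"
      by (auto simp: image_iff)
    also have "(\<lambda>x. u + v - x) ` closed_segment v u = (+) (u+v) ` uminus ` closed_segment v u"
      by (simp add: image_image)
    also have "uminus ` closed_segment v u = closed_segment (- v) (- u)"
      using closed_segment_linear_image[of uminus v u] by (simp add: linear_uminus)
    also have "(+) (u+v) ` \<dots> = closed_segment u v"
      using closed_segment_translation[of "u+v" "-v" "-u"] by simp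
    finally show ?thesis by simp
  qed
  moreover have "(v - (u + v - q)) / (u - (u + v - q)) = (u - q) / (v - q)"
  proof -
    have eq: "v - (u + v - q) = - (u - q)" "u - (u + v - q) = - (v - q)" by auto
    show ?thesis unfolding eq by (rule minus_divide_divide)
  qed
  ultimately have "view_angle (u + v - q) u v = view_angle q v u"
    by (simp add: view_angle_def)
  then show ?thesis using view_angle_swap[of q v u] by simp
qed

lemma view_angle_continuous:
  assumes "q \<notin> closed_segment u v"
  shows "isCont (\<lambda>q. view_angle q u v) q"
proof -
  have "u \<noteq> q" using assms by auto
  then have "isCont (\<lambda>q. (v - q) / (u - q)) q" by (intro continuous_intros) auto
  then have "isCont (\<lambda>q. Arg ((v - q) / (u - q))) q"
    using isCont_o2 continuous_at_Arg ratio_notin_nonpos_Reals[OF assms] by blast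
  moreover have "eventually (\<lambda>q. q \<notin> closed_segment u v) (nhds q)"
    using assms by (intro eventually_nhds_in_open[of "- closed_segment u v", simplified]) auto
  then have "eventually (\<lambda>q. view_angle q u v = Arg ((v - q) / (u - q))) (nhds q)"
    by eventually_elim (simp add: view_angle_def)
  ultimately show ?thesis by (simp add: isCont_cong)
qed

text \<open>
  Off the segment, \<open>Ln ((w - q) / (u - q))\<close> is a primitive of \<open>1 / (w - q)\<close> along it, and its
  imaginary part at \<open>v\<close> is the angle.
\<close>

lemma winding_number_linepath_view_angle:
  assumes "q \<notin> closed_segment u v"
  shows "Re (winding_number (linepath u v) q) = view_angle q u v / (2 * pi)"
proof -
  have uq: "u \<noteq> q" and vq: "v \<noteq> q" using assms by auto
  have *: "((\<lambda>w. 1 / (w - q)) has_contour_integral Ln ((v - q) / (u - q)) - Ln ((u - q) / (u - q))) (linepath u v)"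
  proof (rule contour_integral_primitive[of "closed_segment u v" "\<lambda>w. Ln ((w - q) / (u - q))" "\<lambda>w. 1 / (w - q)" "linepath u v", simplified pathstart_linepath pathfinish_linepath])
    fix x assume x: "x \<in> closed_segment u v"
    have "closed_segment u x \<subseteq> closed_segment u v" using x by (simp add: subset_closed_segment)
    then have "(x - q) / (u - q) \<notin> \<real>\<^sub>\<le>\<^sub>0" using assms ratio_notin_nonpos_Reals[of q u x] by blast
    moreover have "x \<noteq> q" using x assms by auto
    ultimately show "((\<lambda>w. Ln ((w - q) / (u - q))) has_field_derivative 1 / (x - q)) (at x within closed_segment u v)"
      using uq by (auto intro!: derivative_eq_intros)
  qed auto
  have "winding_number (linepath u v) q = 1 / (2 * pi * \<i>) * Ln ((v - q) / (u - q))"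
    using contour_integral_unique[OF *] uq assms
    by (simp add: winding_number_valid_path)
  then have "Re (winding_number (linepath u v) q) = Im (Ln ((v - q) / (u - q))) / (2 * pi)"
    by (simp add: Re_divide Im_divide power2_eq_square)
  then show ?thesis using assms uq vq by (simp add: view_angle_def Arg_def)
qed

section \<open>Closed polygonal paths\<close>

abbreviation side :: "complex list \<Rightarrow> nat \<Rightarrow> complex set" where
  "side ws i \<equiv> closed_segment (ws ! i) (ws ! Suc i)"

lemma polygonal_path_basics:
  assumes "length ws \<ge> 2"
  shows "pathstart (polygonal_path ws) = hd ws" "pathfinish (polygonal_path ws) = last ws"
    "valid_path (polygonal_path ws)"
    "path_image (polygonal_path ws) = (\<Union>i<length ws - 1. side ws i)"
  using assms
proof (induction ws rule: polygonal_path.induct)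
  case (4 u v w vs)
  have len: "length (v # w # vs) \<ge> 2" by simp
  note IH = "4.IH"[OF len]
  case 1 show ?case by simp
  case 2 show ?case using IH(2) by simp
  case 3 show ?case using IH(1,3) by (simp add: valid_path_join)
  case 4
  have "{..<length (u # v # w # vs) - 1} = insert 0 (Suc ` {..<length (v # w # vs) - 1})"
    by (auto simp: lessThan_Suc_eq_insert_0)
  then show ?case using IH(1,4) by (simp add: path_image_join)
qed (auto simp: lessThan_Suc)

lemma arc_linepath_iff: "arc (linepath u v) \<longleftrightarrow> u \<noteq> v"
  using arc_distinct_ends[of "linepath u v"] arc_linepath[of u v] by auto

text \<open>
  Being an arc becomes a condition on pairs of sides, symmetric enough to be read backwards and
  checkable side by side for concrete polygons.
\<close>

lemma arc_polygonal_path_iff: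
  assumes "length ws \<ge> 2"
  shows "arc (polygonal_path ws) \<longleftrightarrow>
    (\<forall>i. Suc i < length ws \<longrightarrow> ws ! i \<noteq> ws ! Suc i) \<and>
    (\<forall>i j z. i < j \<longrightarrow> Suc j < length ws \<longrightarrow> z \<in> side ws i \<longrightarrow> z \<in> side ws j \<longrightarrow>
       j = Suc i \<and> z = ws ! j)"
  using assms
proof (induction ws rule: polygonal_path.induct)
  case (3 u v)
  then show ?case by (auto simp: arc_linepath_iff less_Suc_eq)
next
  case (4 u v w vs)
  let ?r = "v # w # vs"
  have len: "length ?r \<ge> 2" by simp
  note IH = "4.IH"[OF len] and basics = polygonal_path_basics[OF len]
  have "arc (polygonal_path (u # v # w # vs)) \<longleftrightarrow>
     u \<noteq> v \<and> arc (polygonal_path ?r) \<and> closed_segment u v \<inter> path_image (polygonal_path ?r) \<subseteq> {v}"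
    using basics(1) by (simp add: arc_join_eq arc_linepath_iff)
  also have "\<dots> \<longleftrightarrow>
    (\<forall>i. Suc i < length (u # ?r) \<longrightarrow> (u # ?r) ! i \<noteq> (u # ?r) ! Suc i) \<and>
    (\<forall>i j z. i < j \<longrightarrow> Suc j < length (u # ?r) \<longrightarrow> z \<in> side (u # ?r) i \<longrightarrow> z \<in> side (u # ?r) j \<longrightarrow>
       j = Suc i \<and> z = (u # ?r) ! j)" (is "?L \<longleftrightarrow> ?R")
  proof
    assume L: ?L
    then have uv: "u \<noteq> v" and sub: "closed_segment u v \<inter> path_image (polygonal_path ?r) \<subseteq> {v}" by auto
    have r1: "?r ! i \<noteq> ?r ! Suc i" if "Suc i < length ?r" for i
      using L that unfolding IH by blast
    have r2: "j = Suc i \<and> z = ?r ! j"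
      if "i < j" "Suc j < length ?r" "z \<in> side ?r i" "z \<in> side ?r j" for i j z
      using L that unfolding IH by blast
    show ?R
    proof (intro conjI allI impI)
      fix i assume "Suc i < length (u # ?r)"
      then show "(u # ?r) ! i \<noteq> (u # ?r) ! Suc i"
        using uv r1[of "i - 1"] by (cases i) auto
    next
      fix i j z
      assume ij: "i < j" "Suc j < length (u # ?r)" and z: "z \<in> side (u # ?r) i" "z \<in> side (u # ?r) j"
      obtain j' where j': "j = Suc j'" using ij by (cases j) auto
      have zj: "z \<in> side ?r j'" "Suc j' < length ?r" using z ij j' by auto
      have "j = Suc i \<and> z = (u # ?r) ! j"
      proof (cases i)
        case 0
        have "z \<in> path_image (polygonal_path ?r)" using zj basics(4) by auto
        then have zv: "z = v" using z 0 sub by auto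
        have "j' = 0"
        proof (rule ccontr)
          assume "j' \<noteq> 0"
          then have "j' = Suc 0 \<and> z = ?r ! j'" using zj zv by (intro r2) auto
          then show False using r1[of 0] zv by auto
        qed
        then show ?thesis using 0 j' zv by simp
      next
        case (Suc i')
        then show ?thesis using r2[of i' j' z] zj z ij j' by auto
      qed
      then show "j = Suc i" "z = (u # ?r) ! j" by auto
    qed
  next
    assume R: ?R
    have "u \<noteq> v" using R[THEN conjunct1, rule_format, of 0] by simp
    moreover have "arc (polygonal_path ?r)"
      unfolding IH
    proof (intro conjI allI impI)
      fix i assume "Suc i < length ?r"
      then show "?r ! i \<noteq> ?r ! Suc i" using R[THEN conjunct1, rule_format, of "Suc i"] by simp
    next
      fix i j z assume "i < j" "Suc j < length ?r" "z \<in> side ?r i" "z \<in> side ?r j"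
      then show "j = Suc i" "z = ?r ! j"
        using R[THEN conjunct2, rule_format, of "Suc i" "Suc j" z] by auto
    qed
    moreover have "closed_segment u v \<inter> path_image (polygonal_path ?r) \<subseteq> {v}"
    proof
      fix z assume z: "z \<in> closed_segment u v \<inter> path_image (polygonal_path ?r)"
      then obtain j where "Suc j < length ?r" "z \<in> side ?r j" unfolding basics(4) by auto
      then show "z \<in> {v}" using R[THEN conjunct2, rule_format, of 0 "Suc j" z] z by auto
    qed
    ultimately show ?L by blast
  qed
  finally show ?case .
qed auto

lemma winding_number_polygonal_path:
  assumes "length ws \<ge> 2" "q \<notin> path_image (polygonal_path ws)"
  shows "2 * pi * Re (winding_number (polygonal_path ws) q) =
    (\<Sum>i<length ws - 1. view_angle q (ws ! i) (ws ! Suc i))"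
  using assms
proof (induction ws rule: polygonal_path.induct)
  case (3 u v)
  then show ?case by (simp add: winding_number_linepath_view_angle)
next
  case (4 u v w vs)
  let ?r = "v # w # vs"
  have len: "length ?r \<ge> 2" by simp
  note basics = polygonal_path_basics[OF len]
  have q: "q \<notin> closed_segment u v" "q \<notin> path_image (polygonal_path ?r)"
    using "4.prems"(2) basics(1) by (auto simp: path_image_join)
  have "winding_number (polygonal_path (u # ?r)) q =
      winding_number (linepath u v) q + winding_number (polygonal_path ?r) q"
    using q basics by (simp add: winding_number_join valid_path_imp_path)
  then have "2 * pi * Re (winding_number (polygonal_path (u # ?r)) q) =
     view_angle q u v + (\<Sum>i<length ?r - 1. view_angle q (?r ! i) (?r ! Suc i))"
    using "4.IH"[OF len q(2)] winding_number_linepath_view_angle[OF q(1)]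
    by (simp add: field_simps)
  then show ?case
    by (simp add: sum.lessThan_Suc_shift del: sum.lessThan_Suc)
qed auto

definition vertex :: "complex list \<Rightarrow> nat \<Rightarrow> complex" where
  "vertex vs i = vs ! (i mod length vs)"

lemma closing_list_nth:
  assumes "vs \<noteq> []" "i \<le> length vs"
  shows "(vs @ [hd vs]) ! i = vertex vs i"
  using assms by (cases "i = length vs") (auto simp: vertex_def nth_append hd_conv_nth)

text \<open>
  The first side and the remaining open polygon are two arcs that may meet only at their common
  endpoints; the remaining polygon is handled by \<open>arc_polygonal_path_iff\<close>. The exceptional pair is
  the first and the last side, which meet at the closing vertex.
\<close>

lemma simple_closed_polygonal_path_iff:
  fixes vs :: "complex list"
  defines "n \<equiv> length vs" and "w \<equiv> vertex vs"
  assumes "n \<ge> 3"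
  shows "simple_path (closed_polygonal_path vs) \<longleftrightarrow>
    (\<forall>i<n. w i \<noteq> w (Suc i)) \<and>
    (\<forall>i j z. i < j \<longrightarrow> j < n \<longrightarrow> z \<in> closed_segment (w i) (w (Suc i)) \<longrightarrow>
       z \<in> closed_segment (w j) (w (Suc j)) \<longrightarrow>
       (j = Suc i \<and> z = w j) \<or> (i = 0 \<and> j = n - 1 \<and> z = w 0))"
    (is "_ \<longleftrightarrow> ?R1 \<and> ?R2")
proof -
  obtain v0 v1 v2 us where vs: "vs = v0 # v1 # v2 # us"
    using assms by (auto simp: numeral_3_eq_3 Suc_le_length_iff)
  let ?r = "v1 # v2 # us @ [v0]"
  have len: "length ?r \<ge> 2" by simp
  have n: "n = Suc (Suc (Suc (length us)))" by (simp add: n_def vs)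
  note basics = polygonal_path_basics[OF len]
  have w: "w i = (v0 # ?r) ! i" if "i \<le> n" for i
    using closing_list_nth[of vs i] that by (simp add: vs n w_def)
  have wS: "w (Suc i) = ?r ! i" if "i < n" for i
    using w[of "Suc i"] that by simp
  have seg: "closed_segment (w (Suc i)) (w (Suc (Suc i))) = side ?r i" if "Suc i < n" for i
    using w[of "Suc i"] w[of "Suc (Suc i)"] that by simp
  have "simple_path (closed_polygonal_path vs) \<longleftrightarrow>
    v0 \<noteq> v1 \<and> arc (polygonal_path ?r) \<and>
      closed_segment v0 v1 \<inter> path_image (polygonal_path ?r) \<subseteq> {v0, v1}"
    using basics(1,2)
    by (simp add: vs closed_polygonal_path_def simple_path_join_loop_eq arc_linepath_iff)
  also have "\<dots> \<longleftrightarrow> ?R1 \<and> ?R2" (is "?L \<longleftrightarrow> _")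
  proof
    assume L: ?L
    then have sub: "closed_segment v0 v1 \<inter> path_image (polygonal_path ?r) \<subseteq> {v0, v1}" by auto
    have r1: "w i \<noteq> w (Suc i)" if i: "0 < i" "i < n" for i
    proof -
      obtain i' where "i = Suc i'" using i by (cases i) auto
      then show ?thesis
        using L i arc_polygonal_path_iff[OF len] n wS[of i] wS[of i'] by auto
    qed
     have r2: "j = Suc i \<and> z = w j" if ij: "0 < i" "i < j" "j < n"
       "z \<in> closed_segment (w i) (w (Suc i))" "z \<in> closed_segment (w j) (w (Suc j))" for i j z
    proof -
      obtain i' j' where ij': "i = Suc i'" "j = Suc j'"
        using ij by (metis not0_implies_Suc not_less0 less_irrefl)
      have "j' = Suc i' \<and> z = ?r ! j'"
        using L that arc_polygonal_path_iff[OF len] n seg[of i'] seg[of j'] ij' by auto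
      then show ?thesis using ij' wS[of j'] that by auto
    qed
    have R1: ?R1
    proof (intro allI impI)
      fix i assume "i < n"
      then show "w i \<noteq> w (Suc i)" using L r1[of i] w[of 0] w[of 1] n by (cases i) auto
    qed
    moreover have ?R2
    proof (intro allI impI)
      fix i j z assume ij: "i < j" "j < n" and z: "z \<in> closed_segment (w i) (w (Suc i))"
        "z \<in> closed_segment (w j) (w (Suc j))"
      show "(j = Suc i \<and> z = w j) \<or> (i = 0 \<and> j = n - 1 \<and> z = w 0)"
      proof (cases "i = 0")
        case True
        obtain j' where j': "j = Suc j'" using ij by (cases j) auto
        have "z \<in> path_image (polygonal_path ?r)"
          using z(2) j' ij(2) n unfolding basics(4) j' seg[OF ij(2)[unfolded j']] by auto
        then have "z = w 0 \<or> z = w 1" using sub True z w[of 0] w[of 1] n by auto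
        then show ?thesis
        proof
          assume z0: "z = w 0"
          have "j = n - 1"
          proof (rule ccontr)
            assume "j \<noteq> n - 1"
            then have "n - 1 = Suc j \<and> z = w (n - 1)"
              using ij z z0 w[of 0] w[of n] n by (intro r2) (auto simp: nth_append)
            then show False using R1 z0 w[of 0] w[of n] n by (auto simp: nth_append)
          qed
          then show ?thesis using True z0 by simp
        next
          assume z1: "z = w 1"
          have "j = 1"
          proof (rule ccontr)
            assume "j \<noteq> 1"
            then have "j = Suc 1 \<and> z = w j" using ij z z1 by (intro r2) auto
            then show False using R1 z1 n by auto
          qed
          then show ?thesis using True z1 by simp
        qed
      next
        case False
        then show ?thesis using r2[of i j z] ij z by auto
      qed
    qed
    ultimately show "?R1 \<and> ?R2" by blast
  next
    assume R: "?R1 \<and> ?R2"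
    then have R1: "\<And>i. i < n \<Longrightarrow> w i \<noteq> w (Suc i)"
      and R2: "\<And>i j z. i < j \<Longrightarrow> j < n \<Longrightarrow> z \<in> closed_segment (w i) (w (Suc i)) \<Longrightarrow>
       z \<in> closed_segment (w j) (w (Suc j)) \<Longrightarrow>
       (j = Suc i \<and> z = w j) \<or> (i = 0 \<and> j = n - 1 \<and> z = w 0)" by blast+
    have "v0 \<noteq> v1" using R1[of 0] w[of 0] w[of 1] n by simp
    moreover have "arc (polygonal_path ?r)"
      unfolding arc_polygonal_path_iff[OF len]
    proof (intro conjI allI impI)
      fix i assume "Suc i < length ?r"
      then show "?r ! i \<noteq> ?r ! Suc i" using R1[of "Suc i"] wS[of i] wS[of "Suc i"] n by simp
    next
      fix i j z assume ij: "i < j" "Suc j < length ?r" and z: "z \<in> side ?r i" "z \<in> side ?r j"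
      have n': "Suc i < n" "Suc j < n" using ij n by auto
      have "Suc j = Suc (Suc i) \<and> z = w (Suc j)"
        using R2[of "Suc i" "Suc j" z, unfolded seg[OF n'(1)] seg[OF n'(2)]] n' ij z by simp
      then have "j = Suc i \<and> z = ?r ! j" using wS[of j] n' by simp
      then show "j = Suc i" "z = ?r ! j" by auto
    qed
    moreover have "closed_segment v0 v1 \<inter> path_image (polygonal_path ?r) \<subseteq> {v0, v1}"
    proof
      fix z assume z: "z \<in> closed_segment v0 v1 \<inter> path_image (polygonal_path ?r)"
      then obtain j where j: "Suc j < length ?r" "z \<in> side ?r j" unfolding basics(4) by auto
      then have "(Suc j = Suc 0 \<and> z = w (Suc j)) \<or> (0 = (0::nat) \<and> Suc j = n - 1 \<and> z = w 0)"
        using z j n w[of 0] w[of 1] seg[of j] by (intro R2) (simp_all del: closed_segment_eq)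
      then show "z \<in> {v0, v1}" using w[of 0] w[of 1] n by auto
    qed
    ultimately show ?L by blast
  qed
  finally show ?thesis .
qed

lemma closed_polygonal_path_basics:
  fixes vs :: "complex list"
  assumes "length vs \<ge> 3"
  shows "pathfinish (closed_polygonal_path vs) = pathstart (closed_polygonal_path vs)"
    "valid_path (closed_polygonal_path vs)"
    "path_image (closed_polygonal_path vs) =
       (\<Union>i<length vs. closed_segment (vertex vs i) (vertex vs (Suc i)))"
proof -
  have ne: "vs \<noteq> []" and len: "length (vs @ [hd vs]) \<ge> 2" using assms by auto
  note basics = polygonal_path_basics[OF len]
  show "pathfinish (closed_polygonal_path vs) = pathstart (closed_polygonal_path vs)"
    using basics(1,2) ne by (simp add: closed_polygonal_path_def)
  show "valid_path (closed_polygonal_path vs)" using basics(3) by (simp add: closed_polygonal_path_def)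
  show "path_image (closed_polygonal_path vs) =
       (\<Union>i<length vs. closed_segment (vertex vs i) (vertex vs (Suc i)))"
    unfolding closed_polygonal_path_def basics(4)
    by (intro SUP_cong) (auto simp: closing_list_nth[OF ne])
qed

lemma winding_number_closed_polygonal_path:
  assumes "length vs \<ge> 3" "q \<notin> path_image (closed_polygonal_path vs)"
  shows "2 * pi * Re (winding_number (closed_polygonal_path vs) q) =
    (\<Sum>i<length vs. view_angle q (vertex vs i) (vertex vs (Suc i)))"
proof -
  have ne: "vs \<noteq> []" and len: "length (vs @ [hd vs]) \<ge> 2" using assms by auto
  have "(\<Sum>i<length (vs @ [hd vs]) - 1. view_angle q ((vs @ [hd vs]) ! i) ((vs @ [hd vs]) ! Suc i)) =
     (\<Sum>i<length vs. view_angle q (vertex vs i) (vertex vs (Suc i)))"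
    by (intro sum.cong) (auto simp: closing_list_nth[OF ne])
  then show ?thesis
    using winding_number_polygonal_path[OF len] assms(2) by (simp add: closed_polygonal_path_def)
qed

section \<open>The angle at a boundary point\<close>

text \<open>
  The point \<open>p\<close> lies on two segments, to \<open>x\<close> and from \<open>y\<close>; \<open>\<rho>\<close> collects the angles of the other
  sides, which are continuous at \<open>p\<close>. Along a ray from \<open>p\<close> that leaves both segments at once, the angles of the two
  segments converge, so the total, which takes only the values 0 and \<open>2 * pi\<close>, is eventually equal
  to its limit.
\<close>

lemma total_angle_along_ray:
  fixes \<rho> :: "complex \<Rightarrow> real" and p x y :: complex
  defines "tot \<equiv> \<lambda>q. \<rho> q + view_angle q p x + view_angle q y p"
  assumes cont: "isCont \<rho> p" and "x \<noteq> p" "y \<noteq> p"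
    and two_valued: "\<forall>\<^sub>F q in at p. q \<notin> closed_segment p x \<longrightarrow> q \<notin> closed_segment y p \<longrightarrow>
      tot q \<in> {0, 2 * pi}"
    and z: "- (x - p) / z \<notin> \<real>\<^sub>\<le>\<^sub>0" "- z / (y - p) \<notin> \<real>\<^sub>\<le>\<^sub>0"
  defines "L \<equiv> \<rho> p + Arg (- (x - p) / z) + Arg (- z / (y - p))"
  shows "L \<in> {0, 2 * pi}"
    and "\<forall>\<^sub>F t in at_right 0. p + of_real t * z \<notin> closed_segment p x \<and>
      p + of_real t * z \<notin> closed_segment y p \<and> tot (p + of_real t * z) = L"
proof -
  define q where "q = (\<lambda>t::real. p + of_real t * z)"
  have z0: "z \<noteq> 0" using z by auto
  have px: "x - p \<noteq> 0" and py: "y - p \<noteq> 0" using assms by auto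
  have lim_q: "(q \<longlongrightarrow> p) (at_right 0)"
    unfolding q_def by (auto intro!: tendsto_eq_intros)
  have pos: "\<forall>\<^sub>F t::real in at_right 0. t > 0" by (simp add: eventually_at_right_less)
  have lim_q': "filterlim q (at p) (at_right 0)"
    unfolding filterlim_at using lim_q
    by (auto simp: q_def z0 intro!: eventually_mono[OF pos])
  have off_x: "q t \<notin> closed_segment p x" if "t > 0" for t
  proof
    assume "q t \<in> closed_segment p x"
    then obtain u where u: "0 \<le> u" "u \<le> 1" "q t = (1 - u) *\<^sub>R p + u *\<^sub>R x"
      by (auto simp: closed_segment_def)
    then have eq: "of_real t * z = of_real u * (x - p)"
      by (simp add: q_def scaleR_conv_of_real algebra_simps)
    then have "u \<noteq> 0" using that z0 by auto
    then have "- (x - p) / z = of_real (- t / u)"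
      using eq z0 by (simp add: field_simps)
    moreover have "- t / u \<le> 0" using that u by (simp add: divide_nonneg_pos)
    ultimately have "- (x - p) / z \<in> \<real>\<^sub>\<le>\<^sub>0" by (metis nonpos_Reals_of_real_iff)
    then show False using z by simp
  qed
  have off_y: "q t \<notin> closed_segment y p" if "t > 0" for t
  proof
    assume "q t \<in> closed_segment y p"
    then have "q t \<in> closed_segment p y" by (simp add: closed_segment_commute)
    then obtain u where u: "0 \<le> u" "u \<le> 1" "q t = (1 - u) *\<^sub>R p + u *\<^sub>R y"
      by (auto simp: closed_segment_def)
    then have eq: "of_real t * z = of_real u * (y - p)"
      by (simp add: q_def scaleR_conv_of_real algebra_simps)
    then have "- z / (y - p) = of_real (- u / t)"
      using that py by (simp add: field_simps)
    moreover have "- u / t \<le> 0" using that u by (simp add: divide_nonneg_pos)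
    ultimately have "- z / (y - p) \<in> \<real>\<^sub>\<le>\<^sub>0" by (metis nonpos_Reals_of_real_iff)
    then show False using z by simp
  qed
  have vx: "view_angle (q t) p x = Arg (- ((x - p) - of_real t * z) / z)" if "t > 0" for t
  proof -
    have "Arg ((x - q t) / (p - q t)) = Arg (of_real t * ((x - q t) / (p - q t)))"
      using that by (simp only: Arg_times_of_real)
    also have "of_real t * ((x - q t) / (p - q t)) = - ((x - p) - of_real t * z) / z"
      using that z0 by (simp add: q_def field_simps)
    finally show ?thesis using off_x[OF that] by (simp add: view_angle_def)
  qed
  have vy: "view_angle (q t) y p = Arg (- z / ((y - p) - of_real t * z))" if "t > 0" for t
  proof -
    have "Arg ((p - q t) / (y - q t)) = Arg ((- z / ((y - p) - of_real t * z)) * of_real t)"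
      by (simp add: q_def algebra_simps)
    also have "\<dots> = Arg (- z / ((y - p) - of_real t * z))"
      using that by (simp only: Arg_times_of_real2)
    finally show ?thesis using off_y[OF that] by (simp add: view_angle_def)
  qed
  have "((\<lambda>t. Arg (- ((x - p) - of_real t * z) / z)) \<longlongrightarrow> Arg (- (x - p) / z)) (at_right 0)"
    using z z0 by (intro tendsto_Arg) (auto intro!: tendsto_eq_intros)
  moreover have "((\<lambda>t. Arg (- z / ((y - p) - of_real t * z))) \<longlongrightarrow> Arg (- z / (y - p))) (at_right 0)"
    using z py by (intro tendsto_Arg) (auto intro!: tendsto_eq_intros)
  moreover have "((\<lambda>t. \<rho> (q t)) \<longlongrightarrow> \<rho> p) (at_right 0)"
    using cont lim_q isCont_tendsto_compose by blast
  ultimately have "((\<lambda>t. \<rho> (q t) + Arg (- ((x - p) - of_real t * z) / z) +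
      Arg (- z / ((y - p) - of_real t * z))) \<longlongrightarrow> L) (at_right 0)"
    unfolding L_def by (intro tendsto_add)
  moreover have "\<forall>\<^sub>F t in at_right 0. \<rho> (q t) + Arg (- ((x - p) - of_real t * z) / z) +
      Arg (- z / ((y - p) - of_real t * z)) = tot (q t)"
    using pos by eventually_elim (simp add: tot_def vx vy)
  ultimately have lim: "((\<lambda>t. tot (q t)) \<longlongrightarrow> L) (at_right 0)"
    by (rule Lim_transform_eventually)
  have "\<forall>\<^sub>F t in at_right 0. q t \<notin> closed_segment p x \<longrightarrow> q t \<notin> closed_segment y p \<longrightarrow>
      tot (q t) \<in> {0, 2 * pi}"
    using two_valued lim_q' unfolding filterlim_iff by auto
  then have ev: "\<forall>\<^sub>F t in at_right 0. tot (q t) \<in> {0, 2 * pi}"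
    using pos by eventually_elim (simp add: off_x off_y)
  show L: "L \<in> {0, 2 * pi}"
    by (rule Lim_in_closed_set[OF _ ev _ lim]) (auto intro!: finite_imp_closed)
  have "\<forall>\<^sub>F t in at_right 0. dist (tot (q t)) L < 2 * pi"
    using lim by (rule tendstoD) auto
  then show "\<forall>\<^sub>F t in at_right 0. p + of_real t * z \<notin> closed_segment p x \<and>
      p + of_real t * z \<notin> closed_segment y p \<and> tot (p + of_real t * z) = L"
    using ev pos
  proof eventually_elim
    case (elim t)
    then have "tot (q t) = L" using L by (auto simp: dist_real_def)
    then show ?case using elim off_x[of t] off_y[of t] by (simp add: q_def)
  qed
qed

lemma rcis_notin_nonpos_Reals:
  assumes "r > 0" "- pi < \<phi>" "\<phi> < pi"
  shows "rcis r \<phi> \<notin> \<real>\<^sub>\<le>\<^sub>0"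
proof -
  have "Arg (rcis r \<phi>) = \<phi>" using assms by (intro Arg_rcis) auto
  then have "Arg (rcis r \<phi>) \<noteq> pi" using assms by simp
  moreover have "rcis r \<phi> \<noteq> 0" using assms by simp
  ultimately show ?thesis
    by (auto simp: Arg_eq_pi complex_nonpos_Reals_iff complex_eq_iff less_le)
qed

text \<open>
  Let \<open>\<phi>\<close> be the angle from the direction of \<open>x\<close> counterclockwise to that of \<open>y\<close>, so that \<open>\<nu>\<close>
  bisects the sector between them. The limits of the total angle along \<open>\<nu>\<close> and along \<open>- \<nu>\<close> are
  \<open>\<rho> p + 2 * pi - \<phi>\<close> and \<open>\<rho> p - \<phi>\<close>. Two elements of \<open>{0, 2 * pi}\<close> that differ by \<open>2 * pi\<close>
  are \<open>2 * pi\<close> and 0 in this order, hence \<open>\<rho> p = \<phi>\<close>.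
\<close>

lemma boundary_angle:
  fixes \<rho> :: "complex \<Rightarrow> real" and p x y :: complex
  defines "tot \<equiv> \<lambda>q. \<rho> q + view_angle q p x + view_angle q y p"
  assumes cont: "isCont \<rho> p" and xp: "x \<noteq> p" and yp: "y \<noteq> p"
    and no_spike: "(y - p) / (x - p) \<notin> \<real>\<^sub>\<ge>\<^sub>0"
    and two_valued: "\<forall>\<^sub>F q in at p. q \<notin> closed_segment p x \<longrightarrow> q \<notin> closed_segment y p \<longrightarrow>
      tot q \<in> {0, 2 * pi}"
  defines "\<nu> \<equiv> sgn (x - p) * cis (Arg2pi ((y - p) / (x - p)) / 2)"
  shows "\<rho> p = pi - Arg ((x - p) / (p - y))"
    and "\<forall>\<^sub>F t in at_right 0. p + of_real t * \<nu> \<notin> closed_segment p x \<and>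
      p + of_real t * \<nu> \<notin> closed_segment y p \<and> tot (p + of_real t * \<nu>) = 2 * pi"
    and "\<forall>\<^sub>F t in at_right 0. p + of_real t * (- \<nu>) \<notin> closed_segment p x \<and>
      p + of_real t * (- \<nu>) \<notin> closed_segment y p \<and> tot (p + of_real t * (- \<nu>)) = 0"
proof -
  define e f \<phi> where "e = x - p" and "f = y - p" and "\<phi> = Arg2pi (f / e)"
  have e0: "e \<noteq> 0" and f0: "f \<noteq> 0" using xp yp by (auto simp: e_def f_def)
  have "\<phi> \<noteq> 0" using no_spike
    by (auto simp: \<phi>_def Arg2pi_eq_0 e_def f_def complex_nonneg_Reals_iff complex_is_Real_iff)
  then have \<phi>: "0 < \<phi>" "\<phi> < 2 * pi"
    using Arg2pi_ge_0[of "f / e"] Arg2pi_lt_2pi[of "f / e"] by (auto simp: \<phi>_def)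
  have fe: "f = rcis (norm f) \<phi> * sgn e"
  proof -
    have "f / e = of_real (norm (f / e)) * cis \<phi>"
      using Arg2pi_eq[of "f / e"] by (simp add: \<phi>_def cis_conv_exp)
    then have "f = of_real (norm f / norm e) * cis \<phi> * e" using e0 by (simp add: norm_divide field_simps)
    then show ?thesis using e0 by (simp add: rcis_def sgn_div_norm scaleR_conv_of_real field_simps)
  qed
  have ee: "e = of_real (norm e) * sgn e" using e0 by (simp add: sgn_div_norm scaleR_conv_of_real)
  have s0: "sgn e \<noteq> 0" using e0 by (simp add: sgn_zero_iff)
  have nu: "\<nu> = sgn e * cis (\<phi> / 2)" by (simp add: \<nu>_def e_def f_def \<phi>_def)
  \<comment> \<open>All four quotients are of this shape, so their arguments can be read off.\<close>
  have eval: "c * sgn e * cis a / (d * sgn e * cis b) = (c / d) * cis (a - b)" for c d a b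
    using s0 by (simp flip: cis_divide)
  have p1: "- e / \<nu> = rcis (norm e) (pi - \<phi> / 2)"
  proof -
    have "- e / \<nu> = (of_real (norm e) * sgn e * cis pi) / (1 * sgn e * cis (\<phi> / 2))"
      by (subst ee) (simp add: nu)
    then show ?thesis unfolding eval by (simp add: rcis_def)
  qed
  have p2: "- \<nu> / f = rcis (1 / norm f) (pi - \<phi> / 2)"
  proof -
    have "- \<nu> / f = (1 * sgn e * cis (pi + \<phi> / 2)) / (of_real (norm f) * sgn e * cis \<phi>)"
      by (subst fe) (simp add: nu rcis_def mult_ac flip: cis_mult)
    then show ?thesis unfolding eval by (simp add: rcis_def field_simps)
  qed
  have p3: "- e / (- \<nu>) = rcis (norm e) (- \<phi> / 2)"
  proof -
    have "- e / (- \<nu>) = (of_real (norm e) * sgn e * cis 0) / (1 * sgn e * cis (\<phi> / 2))"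
      by (subst ee) (simp add: nu)
    then show ?thesis unfolding eval by (simp add: rcis_def)
  qed
  have p4: "- (- \<nu>) / f = rcis (1 / norm f) (- \<phi> / 2)"
  proof -
    have "- (- \<nu>) / f = (1 * sgn e * cis (\<phi> / 2)) / (of_real (norm f) * sgn e * cis \<phi>)"
      by (subst fe) (simp add: nu rcis_def mult_ac)
    then show ?thesis unfolding eval by (simp add: rcis_def field_simps)
  qed
  have A: "Arg (rcis r \<theta>) = \<theta>" if "r > 0" "- pi < \<theta>" "\<theta> < pi" for r \<theta>
    using that by (intro Arg_rcis) auto
  have ar: "Arg (rcis r (pi - \<phi> / 2)) = pi - \<phi> / 2" "Arg (rcis r (- \<phi> / 2)) = - \<phi> / 2"
    "Arg (rcis r (pi - \<phi>)) = pi - \<phi>" if "r > 0" for r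
    by (rule A[OF that]; use \<phi> in linarith)+
  have ne: "norm e > 0" "1 / norm f > 0" using e0 f0 by auto
  note ray = total_angle_along_ray[OF cont xp yp two_valued[unfolded tot_def]]
  have "- e / \<nu> \<notin> \<real>\<^sub>\<le>\<^sub>0" "- \<nu> / f \<notin> \<real>\<^sub>\<le>\<^sub>0"
    subgoal unfolding p1 using \<phi> ne by (intro rcis_notin_nonpos_Reals) linarith+
    subgoal unfolding p2 using \<phi> ne by (intro rcis_notin_nonpos_Reals) linarith+
    done
  note ray1 = ray[OF this[unfolded e_def f_def]]
  have "- e / (- \<nu>) \<notin> \<real>\<^sub>\<le>\<^sub>0" "- (- \<nu>) / f \<notin> \<real>\<^sub>\<le>\<^sub>0"
    subgoal unfolding p3 using \<phi> ne by (intro rcis_notin_nonpos_Reals) linarith+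
    subgoal unfolding p4 using \<phi> ne by (intro rcis_notin_nonpos_Reals) linarith+
    done
  note ray2 = ray[OF this[unfolded e_def f_def]]
  have L1: "\<rho> p + Arg (- (x - p) / \<nu>) + Arg (- \<nu> / (y - p)) = \<rho> p + 2 * pi - \<phi>"
    unfolding e_def[symmetric] f_def[symmetric] p1 p2 ar[OF ne(1)] ar[OF ne(2)] by linarith
  have L2: "\<rho> p + Arg (- (x - p) / (- \<nu>)) + Arg (- (- \<nu>) / (y - p)) = \<rho> p - \<phi>"
    unfolding e_def[symmetric] f_def[symmetric] p3 p4 ar[OF ne(1)] ar[OF ne(2)] by linarith
  have \<rho>: "\<rho> p = \<phi>"
  proof -
    have "\<rho> p + 2 * pi - \<phi> = 0 \<or> \<rho> p + 2 * pi - \<phi> = 2 * pi" using ray1(1) unfolding L1 by blast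
    moreover have "\<rho> p - \<phi> = 0 \<or> \<rho> p - \<phi> = 2 * pi" using ray2(1) unfolding L2 by blast
    ultimately show ?thesis using pi_gt_zero by (elim disjE) linarith+
  qed
  have "(x - p) / (p - y) = rcis (norm e / norm f) (pi - \<phi>)"
  proof -
    have "(x - p) / (p - y) = (of_real (norm e) * sgn e * cis pi) / (of_real (norm f) * sgn e * cis \<phi>)"
    proof -
      have "(x - p) / (p - y) = e * cis pi / f"
        using minus_divide_divide[of "x - p" "p - y"] by (simp add: e_def f_def)
      also have "\<dots> = (of_real (norm e) * sgn e * cis pi) / (of_real (norm f) * sgn e * cis \<phi>)"
        by (subst ee, subst fe) (simp add: rcis_def mult_ac)
      finally show ?thesis .
    qed
    then show ?thesis unfolding eval by (simp add: rcis_def)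
  qed
  then have "Arg ((x - p) / (p - y)) = pi - \<phi>" using ar(3)[of "norm e / norm f"] e0 f0 by simp
  then show "\<rho> p = pi - Arg ((x - p) / (p - y))" using \<rho> by simp
  show "\<forall>\<^sub>F t in at_right 0. p + of_real t * \<nu> \<notin> closed_segment p x \<and>
      p + of_real t * \<nu> \<notin> closed_segment y p \<and> tot (p + of_real t * \<nu>) = 2 * pi"
    using ray1(2) unfolding L1 unfolding \<rho> tot_def by simp
  show "\<forall>\<^sub>F t in at_right 0. p + of_real t * (- \<nu>) \<notin> closed_segment p x \<and>
      p + of_real t * (- \<nu>) \<notin> closed_segment y p \<and> tot (p + of_real t * (- \<nu>)) = 0"
    using ray2(2) unfolding L2 unfolding \<rho> tot_def by simp
qed

section \<open>The sum of the exterior angles\<close>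

text \<open>
  The two edge vectors at a vertex and their sum lie in a common half plane.
\<close>

lemma Arg_chain_corner:
  assumes "0 \<notin> closed_segment e (f::complex)"
  shows "Arg ((e + f) / e) + Arg (f / (e + f)) = Arg (f / e)"
proof -
  obtain c where c: "\<And>z. z \<in> closed_segment e f \<Longrightarrow> Re (z * c) > 0"
    using convex_avoiding_0_half_plane[of "closed_segment e f"] assms by auto
  have "Re (e * c) > 0" "Re (f * c) > 0" using c[of e] c[of f] by auto
  moreover from this have "Re ((e + f) * c) > 0" by (simp add: algebra_simps)
  ultimately show ?thesis by (simp only: Arg_divide_half_plane[of _ c])
qed

text \<open>
  The differences between points of two disjoint segments form a compact convex set that avoids 0;
  so the direction from one segment to the other does not rotate around the boundary of the
  parameter square.
\<close>

lemma Arg_chain_disjoint_segments: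
  fixes u v x y :: complex
  assumes "closed_segment u v \<inter> closed_segment x y = {}"
  shows "Arg ((y - u) / (x - u)) + Arg ((y - v) / (y - u)) =
         Arg ((x - v) / (x - u)) + Arg ((y - v) / (x - v))"
proof -
  define K where "K = (\<Union>p \<in> closed_segment x y. \<Union>q \<in> closed_segment u v. {p - q})"
  have "convex K" unfolding K_def by (intro convex_differences) auto
  have "K = {p - q | p q. p \<in> closed_segment x y \<and> q \<in> closed_segment u v}"
    unfolding K_def by auto
  then have "closed K" using compact_differences[of "closed_segment x y" "closed_segment u v"]
    by (simp add: compact_imp_closed)
  have "0 \<notin> K" using assms by (auto simp: K_def)
  have "x - u \<in> K" "y - u \<in> K" "x - v \<in> K" "y - v \<in> K" unfolding K_def by auto
  then show ?thesis
    using Arg_chain_convex[OF \<open>convex K\<close> \<open>closed K\<close> \<open>0 \<notin> K\<close>, of "x - u" "y - u" "y - v"]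
      Arg_chain_convex[OF \<open>convex K\<close> \<open>closed K\<close> \<open>0 \<notin> K\<close>, of "x - u" "x - v" "y - v"] by simp
qed

locale simple_polygon =
  fixes n :: nat and w :: "nat \<Rightarrow> complex"
  assumes n3: "3 \<le> n" and periodic: "w (i + n) = w i"
    and distinct_ends: "i < n \<Longrightarrow> w i \<noteq> w (Suc i)"
    and sides_meet: "\<lbrakk>i < j; j < n; z \<in> closed_segment (w i) (w (Suc i));
        z \<in> closed_segment (w j) (w (Suc j))\<rbrakk> \<Longrightarrow>
      (j = Suc i \<and> z = w j) \<or> (i = 0 \<and> j = n - 1 \<and> z = w 0)"
begin

abbreviation seg :: "nat \<Rightarrow> complex set" where
  "seg i \<equiv> closed_segment (w i) (w (Suc i))"

definition boundary :: "complex set"  (\<open>\<Gamma>\<close>) where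
  "\<Gamma> = (\<Union>i<n. seg i)"

definition edge :: "nat \<Rightarrow> complex" where
  "edge i = w (Suc i) - w i"

definition turn :: "nat \<Rightarrow> real" where
  "turn i = Arg (edge (Suc i) / edge i)"

definition total_angle :: "complex \<Rightarrow> real" where
  "total_angle q = (\<Sum>i<n. view_angle q (w i) (w (Suc i)))"

lemma w_n: "w n = w 0" "w (Suc n) = w (Suc 0)"
  using periodic[of 0] periodic[of 1] by simp_all

lemma w_mod: "w (i mod n) = w i"
proof -
  have "w (j + k * n) = w j" for j k
  proof (induction k)
    case (Suc k)
    then show ?case using periodic[of "j + k * n"] by (simp add: algebra_simps)
  qed simp
  from this[of "i mod n" "i div n"] show ?thesis by simp
qed

lemma edge_n: "edge n = edge 0" by (simp add: edge_def w_n)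

lemma edge_nonzero: "i \<le> n \<Longrightarrow> edge i \<noteq> 0"
  using distinct_ends[of i] distinct_ends[of 0] n3 edge_n
  by (cases "i = n") (auto simp: edge_def)

lemma adjacent_sides:
  assumes "i < n" "z \<in> seg i" "z \<in> seg (Suc i)"
  shows "z = w (Suc i)"
proof (cases "Suc i = n")
  case True
  then show ?thesis using sides_meet[of 0 i z] assms n3 w_n by auto
next
  case False
  then show ?thesis using sides_meet[of i "Suc i" z] assms n3 by auto
qed

lemma disjoint_sides:
  assumes "Suc i < j" "j < n" "\<not> (i = 0 \<and> j = n - 1)"
  shows "seg i \<inter> seg j = {}"
  using sides_meet[of i j] assms by fastforce

text \<open>
  If the next edge pointed straight back, the two sides would overlap: the point at the weight \<open>t\<close>
  on the next edge would also lie on the previous one.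
\<close>

lemma no_spike:
  assumes "i < n"
  shows "0 \<notin> closed_segment (edge i) (edge (Suc i))"
proof
  assume "0 \<in> closed_segment (edge i) (edge (Suc i))"
  then obtain t where t: "0 \<le> t" "t \<le> 1" "(1 - t) *\<^sub>R edge i + t *\<^sub>R edge (Suc i) = 0"
    by (auto simp: closed_segment_def)
  define z where "z = w (Suc i) + t *\<^sub>R edge (Suc i)"
  have z': "z = w (Suc i) - (1 - t) *\<^sub>R edge i"
    using t(3) by (simp add: z_def add_eq_0_iff2 algebra_simps)
  have "z = (1 - t) *\<^sub>R w (Suc i) + t *\<^sub>R w (Suc (Suc i))"
    by (simp add: z_def edge_def algebra_simps)
  then have "z \<in> seg (Suc i)" using t by (auto simp: closed_segment_def)
  moreover have "z = (1 - t) *\<^sub>R w i + t *\<^sub>R w (Suc i)"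
    unfolding z' by (simp add: edge_def algebra_simps)
  then have "z \<in> seg i" using t by (auto simp: closed_segment_def)
  ultimately have "z = w (Suc i)" using adjacent_sides assms by blast
  then have "t = 0" using edge_nonzero[of "Suc i"] assms by (simp add: z_def)
  then show False using t edge_nonzero[of i] assms by simp
qed

text \<open>
  The discrete form of Hopf's argument. Write \<open>c i j\<close> for the vector from \<open>w i\<close> to \<open>w j\<close>, with
  \<open>0 \<le> i < j \<le> n\<close>, and \<open>a i j\<close>, \<open>b i j\<close> for its rotation when \<open>j\<close> or \<open>i\<close> is increased by one.
  Rotation around each elementary square is 0, except at the corner \<open>(0, n)\<close>, where the vector
  vanishes and which is bypassed through \<open>(1, n - 1)\<close>; along the diagonal two steps make up one
  exterior angle. The leg \<open>i = 0\<close> and the leg \<open>j = n\<close> both show how the direction from \<open>w 0\<close> to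
  the other vertices rotates, in the latter case with opposite vectors.
\<close>

lemma sum_turn_eq:
  "(\<Sum>i<n. turn i) = 2 * (total_angle (w 0) + turn (n - 1))"
proof -
  define c where "c i j = w j - w i" for i j
  define a where "a i j = Arg (c i (Suc j) / c i j)" for i j
  define b where "b i j = Arg (c (Suc i) j / c i j)" for i j
  define S where "S = (\<Sum>j = 1..<n - 1. a 0 j)"
  have corner: "Arg (c i (Suc (Suc i)) / c i (Suc i)) +
      Arg (c (Suc i) (Suc (Suc i)) / c i (Suc (Suc i))) = turn i" if "i < n" for i
    using Arg_chain_corner[OF no_spike[OF that]] by (simp add: c_def turn_def edge_def)
  have square: "a i j - a (Suc i) j = b i j - b i (Suc j)"
    if "Suc i < j" "j < n" "\<not> (i = 0 \<and> j = n - 1)" for i j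
    using Arg_chain_disjoint_segments[OF disjoint_sides[OF that]]
    by (simp add: a_def b_def c_def)
  have telescope: "(\<Sum>j = Suc (Suc i)..<m. a i j) - (\<Sum>j = Suc (Suc i)..<m. a (Suc i) j) =
      b i (Suc (Suc i)) - b i m"
    if "Suc (Suc i) \<le> m" "m \<le> n" "i = 0 \<longrightarrow> m < n" for i m
  proof -
    have "(\<Sum>j = Suc (Suc i)..<m. a i j) - (\<Sum>j = Suc (Suc i)..<m. a (Suc i) j) =
        (\<Sum>j = Suc (Suc i)..<m. b i j - b i (Suc j))"
      unfolding sum_subtractf[symmetric] using that by (intro sum.cong square) auto
    also have "\<dots> = b i (Suc (Suc i)) - b i m"
      using sum_Suc_diff'[OF that(1), of "\<lambda>j. - b i j"] by simp
    finally show ?thesis .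
  qed
  have row: "(\<Sum>j = Suc i..<n. a i j) = turn i - b i n + (\<Sum>j = Suc (Suc i)..<n. a (Suc i) j)"
    if "1 \<le> i" "Suc i < n" for i
  proof -
    have "(\<Sum>j = Suc i..<n. a i j) = a i (Suc i) + (\<Sum>j = Suc (Suc i)..<n. a i j)"
      using that by (simp add: sum.atLeast_Suc_lessThan)
    then show ?thesis using telescope[of i n] corner[of i] that by (simp add: a_def b_def)
  qed
  have rows: "(\<Sum>j = Suc i..<n. a i j) = (\<Sum>k = i..<n - 1. turn k - b k n)"
    if "1 \<le> i" "i < n" for i
    using that(2,1)
  proof (induction i rule: strict_inc_induct)
    case (base i)
    then show ?case by simp
  next
    case (step i)
    then have "(\<Sum>k = i..<n - 1. turn k - b k n) = turn i - b i n + (\<Sum>k = Suc i..<n - 1. turn k - b k n)"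
      by (intro sum.atLeast_Suc_lessThan) auto
    then show ?case using step row[of i] by simp
  qed
  \<comment> \<open>The leg \<open>j = n\<close> runs through the opposites of the vectors of the leg \<open>i = 0\<close>.\<close>
  have b_n: "b i n = a 0 i" for i
    using minus_divide_divide[of "w (Suc i) - w 0" "w i - w 0"] by (simp add: a_def b_def c_def w_n)
  \<comment> \<open>The detour around the missing corner contributes the exterior angle at \<open>w 0\<close>.\<close>
  have last_corner: "b 0 (n - 1) + a 1 (n - 1) = turn (n - 1)"
  proof -
    have n1: "Suc (n - 1) = n" using n3 by simp
    have eq: "c 1 (n - 1) = - c (n - 1) (Suc n)" "c 0 (n - 1) = - c (n - 1) n" "c 1 n = - c n (Suc n)"
      by (simp_all add: c_def w_n)
    have "b 0 (n - 1) + a 1 (n - 1) =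
        Arg (c (n - 1) (Suc n) / c (n - 1) n) + Arg (c n (Suc n) / c (n - 1) (Suc n))"
      unfolding a_def b_def n1 One_nat_def[symmetric] eq minus_divide_divide ..
    then show ?thesis using corner[of "n - 1"] n3 by (simp only: n1)
  qed
  have "S = a 0 1 + (\<Sum>j = 2..<n - 1. a 0 j)"
    unfolding S_def using n3 by (simp add: sum.atLeast_Suc_lessThan numeral_2_eq_2)
  also have "(\<Sum>j = 2..<n - 1. a 0 j) = b 0 2 - b 0 (n - 1) + (\<Sum>j = 2..<n - 1. a 1 j)"
  proof -
    have "Suc (Suc 0) \<le> n - 1" using n3 by linarith
    then show ?thesis using telescope[of 0 "n - 1"] n3 by (simp add: numeral_2_eq_2)
  qed
  also have "(\<Sum>j = 2..<n - 1. a 1 j) = (\<Sum>j = 2..<n. a 1 j) - a 1 (n - 1)"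
  proof -
    have "{2..<n} = insert (n - 1) {2..<n - 1}" using n3 by auto
    then show ?thesis by simp
  qed
  also have "(\<Sum>j = 2..<n. a 1 j) = (\<Sum>k = 1..<n - 1. turn k) - S"
    using rows[of 1] n3 by (simp add: S_def b_n sum_subtractf numeral_2_eq_2)
  also have "a 0 1 + (b 0 2 - b 0 (n - 1) + ((\<Sum>k = 1..<n - 1. turn k) - S - a 1 (n - 1))) =
      turn 0 + (\<Sum>k = 1..<n - 1. turn k) - S - turn (n - 1)"
    using corner[of 0] last_corner n3 by (simp add: a_def b_def numeral_2_eq_2)
  also have "turn 0 + (\<Sum>k = 1..<n - 1. turn k) = (\<Sum>k<n - 1. turn k)"
    using n3 by (simp add: lessThan_atLeast0 sum.atLeast_Suc_lessThan)
  also have "(\<Sum>k<n - 1. turn k) = (\<Sum>k<n. turn k) - turn (n - 1)"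
    using n3 sum.lessThan_Suc[of turn "n - 1"] by simp
  finally have "(\<Sum>k<n. turn k) = 2 * (S + turn (n - 1))" by simp
  moreover have "total_angle (w 0) = S"
  proof -
    have "{..<n} = insert 0 (insert (n - 1) {1..<n - 1})" using n3 by auto
    then have "total_angle (w 0) = (\<Sum>j = 1..<n - 1. view_angle (w 0) (w j) (w (Suc j)))"
      using n3 by (simp add: total_angle_def view_angle_def w_n)
    also have "\<dots> = S"
      unfolding S_def
    proof (intro sum.cong refl)
      fix j assume j: "j \<in> {1..<n - 1}"
      then have "w 0 \<notin> seg j"
        using sides_meet[of 0 j "w 0"] distinct_ends[of 0] n3 by auto
      then show "view_angle (w 0) (w j) (w (Suc j)) = a 0 j"
        by (simp add: view_angle_def a_def c_def)
    qed
    finally show ?thesis .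
  qed
  ultimately show ?thesis by simp
qed

end

section \<open>Sums of angles over the lattice\<close>

definition lattice_pt :: "int \<times> int \<Rightarrow> complex" where
  "lattice_pt p = Complex (of_int (fst p)) (of_int (snd p))"

lemma lattice_pt_add: "lattice_pt (p + q) = lattice_pt p + lattice_pt q"
  and lattice_pt_minus: "lattice_pt (- p) = - lattice_pt p"
  by (simp_all add: lattice_pt_def complex_eq_iff)

lemma lattice_pt_diff: "lattice_pt (p - q) = lattice_pt p - lattice_pt q"
  using lattice_pt_add[of p "- q"] lattice_pt_minus[of q] by simp

lemma inj_lattice_pt: "inj lattice_pt"
  by (auto simp: inj_def lattice_pt_def complex_eq_iff)

lemma range_lattice_pt: "range lattice_pt = lattice_points"
proof
  show "lattice_points \<subseteq> range lattice_pt"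
  proof
    fix z assume "z \<in> lattice_points"
    then obtain x y where "Re z = of_int x" "Im z = of_int y"
      by (auto simp: lattice_points_def elim!: Ints_cases)
    then have "z = lattice_pt (x, y)" by (simp add: lattice_pt_def complex_eq_iff)
    then show "z \<in> range lattice_pt" by blast
  qed
qed (auto simp: lattice_pt_def lattice_points_def)

definition window :: "nat \<Rightarrow> (int \<times> int) set" where
  "window N = {- int N..int N} \<times> {- int N..int N}"

lemma finite_window [simp]: "finite (window N)" by (simp add: window_def)

lemma window_mono: "M \<le> N \<Longrightarrow> window M \<subseteq> window N" by (auto simp: window_def)

lemma norm_outside_window:
  assumes "p \<notin> window N"
  shows "norm (lattice_pt p) > N"
proof -
  have "\<bar>fst p\<bar> > int N \<or> \<bar>snd p\<bar> > int N"
    using assms by (cases p) (auto simp: window_def)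
  then have "\<bar>Re (lattice_pt p)\<bar> > N \<or> \<bar>Im (lattice_pt p)\<bar> > N"
    unfolding lattice_pt_def by (auto simp flip: of_int_abs) 
  then show ?thesis using abs_Re_le_cmod[of "lattice_pt p"] abs_Im_le_cmod[of "lattice_pt p"] by linarith
qed

text \<open>
  The two ratios whose arguments are compared have quotient \<open>1 + \<epsilon>\<close> with \<open>\<epsilon>\<close> of the order of
  \<open>1 / (norm p)\<^sup>2\<close>, and far away both ratios are close to 1, so that the difference of their
  arguments is the argument of this quotient.
\<close>

lemma view_angle_far_variation:
  fixes u v z :: complex
  obtains C R where "C \<ge> 0" "R > 0"
    "\<And>p. norm p \<ge> R \<Longrightarrow> \<bar>view_angle (p + z) u v - view_angle p u v\<bar> \<le> C / (norm p)\<^sup>2"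
proof
  define R where "R = 4 * (norm u + norm v + norm z) + 1"
  show "8 * norm z * norm (v - u) \<ge> 0" by simp
  show "R > 0" by (simp add: R_def add_nonneg_pos)
  fix p :: complex assume p: "norm p \<ge> R"
  then have p4: "4 * (norm u + norm v + norm z) < norm p" by (simp add: R_def)
  have p0: "norm p > 0" using p \<open>R > 0\<close> by linarith
  have vu: "norm (v - u) \<le> norm p / 4"
    using norm_triangle_ineq4[of v u] p4 norm_ge_zero[of z] by argo
  have far: "norm (a - (p + y)) \<ge> norm p / 2" if "norm a + norm y \<le> norm u + norm v + norm z" for a y
    using that p4 norm_triangle_ineq3[of p "a - y"] norm_triangle_ineq4[of a y]
    by (simp add: norm_minus_commute algebra_simps)
  have off: "p + y \<notin> closed_segment u v" if "norm y \<le> norm z" for y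
  proof
    assume "p + y \<in> closed_segment u v"
    moreover have "closed_segment u v \<subseteq> cball 0 (norm u + norm v)"
      by (intro closed_segment_subset) auto
    ultimately have "norm (p + y) \<le> norm u + norm v" by auto
    then show False
      using p4 that norm_diff_triangle_ineq[of p 0 "-y" 0] norm_triangle_ineq2[of p "- y"]
        norm_ge_zero[of u] norm_ge_zero[of v] norm_ge_zero[of z] by simp
  qed
  define r where "r y = (v - (p + y)) / (u - (p + y))" for y
  have r: "Re (r y) > 0" if y: "norm y \<le> norm z" for y
  proof -
    have ge: "norm (u - (p + y)) \<ge> norm p / 2" using y by (intro far) (simp add: add_increasing)
    then have "u - (p + y) \<noteq> 0" using p0 by auto
    then have "r y - 1 = (v - u) / (u - (p + y))" by (simp add: r_def field_simps)
    then have "norm (r y - 1) = norm (v - u) / norm (u - (p + y))" by (simp add: norm_divide)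
    also have "\<dots> \<le> (norm p / 4) / (norm p / 2)" using vu ge p0 by (intro frac_le) auto
    also have "\<dots> < 1" using p0 by simp
    finally show ?thesis using abs_Re_le_cmod[of "r y - 1"] by simp
  qed
  define \<epsilon> where "\<epsilon> = z * (v - u) / ((u - (p + z)) * (v - p))"
  have ge: "norm (u - (p + z)) \<ge> norm p / 2" "norm (v - p) \<ge> norm p / 2" "norm (u - p) \<ge> norm p / 2"
    using far[of u z] far[of v 0] far[of u 0] by auto
  then have nz: "u - (p + z) \<noteq> 0" "v - p \<noteq> 0" "u - p \<noteq> 0" using p0 by auto
  have \<epsilon>: "norm \<epsilon> \<le> 4 * norm z * norm (v - u) / (norm p)\<^sup>2"
  proof -
    have "norm \<epsilon> = norm z * norm (v - u) / (norm (u - (p + z)) * norm (v - p))"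
      by (simp add: \<epsilon>_def norm_divide norm_mult)
    also have "\<dots> \<le> norm z * norm (v - u) / ((norm p / 2) * (norm p / 2))"
      using ge p0 by (intro divide_left_mono mult_mono mult_pos_pos) auto
    finally show ?thesis by (simp add: power2_eq_square mult_ac)
  qed
  have small: "norm \<epsilon> < 1 / 2"
  proof -
    have "norm z * norm (v - u) \<le> (norm p / 4) * (norm p / 4)"
    proof (intro mult_mono vu)
      show "norm z \<le> norm p / 4" using p4 norm_ge_zero[of u] norm_ge_zero[of v] by argo
    qed auto
    then have "4 * norm z * norm (v - u) / (norm p)\<^sup>2 \<le> 1 / 4"
      using p0 by (simp add: field_simps power2_eq_square)
    then show ?thesis using \<epsilon> by linarith
  qed
  have "r z / r 0 = 1 + \<epsilon>"
  proof -
    define D where "D = (u - (p + z)) * (v - p)"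
    have "(v - (p + z)) * (u - p) = D + z * (v - u)" by (simp add: D_def algebra_simps)
    then have "r z / r 0 = (D + z * (v - u)) / D" by (simp add: r_def D_def)
    also have "\<dots> = 1 + \<epsilon>" using nz by (simp add: \<epsilon>_def D_def add_divide_distrib)
    finally show ?thesis .
  qed
  then have "Arg (1 + \<epsilon>) = Arg (r z) - Arg (r 0)"
    using Arg_divide_Re_pos[OF r[of 0] r[of z]] by simp
  also have "\<dots> = view_angle (p + z) u v - view_angle p u v"
    using off[of z] off[of 0] by (simp add: r_def view_angle_def)
  finally have eq: "Arg (1 + \<epsilon>) = view_angle (p + z) u v - view_angle p u v" .
  have "1 + \<epsilon> \<noteq> 0" using small by (auto simp: add_eq_0_iff)
  then have "\<bar>Arg (1 + \<epsilon>)\<bar> \<le> norm (Ln (1 + \<epsilon>))"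
    using abs_Im_le_cmod by (simp add: Arg_eq_Im_Ln)
  also have "\<dots> \<le> 2 * norm \<epsilon>" by (rule norm_Ln_le[OF small])
  finally show "\<bar>view_angle (p + z) u v - view_angle p u v\<bar> \<le> 8 * norm z * norm (v - u) / (norm p)\<^sup>2"
    using \<epsilon> unfolding eq by simp
qed

lemma card_window_shift:
  fixes s :: "int \<times> int"
  defines "k \<equiv> nat \<bar>fst s\<bar> + nat \<bar>snd s\<bar>"
  shows "card (window N - (+) s ` window N) \<le> k * (2 * N + 1)"
    and "card ((+) s ` window N - window N) \<le> k * (2 * N + 1)"
proof -
  define X where "X a = {a - int N..a + int N}" for a
  have XX: "card (X a) = 2 * N + 1" for a by (simp add: X_def)
  have Xd: "card (X a - X b) \<le> nat \<bar>a - b\<bar>" for a b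
  proof -
    have "X a - X b \<subseteq> (if a \<le> b then {a - int N..<b - int N} else {b + int N<..a + int N})"
      by (auto simp: X_def)
    then have "card (X a - X b) \<le> card (if a \<le> b then {a - int N..<b - int N} else {b + int N<..a + int N})"
      by (intro card_mono) auto
    also have "\<dots> \<le> nat \<bar>a - b\<bar>" by auto
    finally show ?thesis .
  qed
  have box: "card (X a \<times> X b - X c \<times> X d) \<le> (nat \<bar>a - c\<bar> + nat \<bar>b - d\<bar>) * (2 * N + 1)" for a b c d
  proof -
    have "X a \<times> X b - X c \<times> X d \<subseteq> (X a - X c) \<times> X b \<union> X a \<times> (X b - X d)" by auto
    then have "card (X a \<times> X b - X c \<times> X d) \<le> card ((X a - X c) \<times> X b \<union> X a \<times> (X b - X d))"
      by (intro card_mono) (auto simp: X_def)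
    also have "\<dots> \<le> card (X a - X c) * (2 * N + 1) + (2 * N + 1) * card (X b - X d)"
      using card_Un_le[of "(X a - X c) \<times> X b" "X a \<times> (X b - X d)"] by (simp add: card_cartesian_product XX)
    also have "\<dots> \<le> nat \<bar>a - c\<bar> * (2 * N + 1) + (2 * N + 1) * nat \<bar>b - d\<bar>"
      using Xd[of a c] Xd[of b d] by (intro add_mono mult_le_mono) auto
    finally show ?thesis by (simp add: algebra_simps)
  qed
  have W: "window N = X 0 \<times> X 0" by (simp add: window_def X_def)
  have sW: "(+) s ` window N = X (fst s) \<times> X (snd s)"
  proof -
    have "p \<in> (+) s ` window N \<longleftrightarrow> p - s \<in> window N" for p
      by (auto simp: image_iff intro!: bexI[of _ "p - s"])
    then show ?thesis by (cases s) (auto simp: window_def X_def)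
  qed
  show "card (window N - (+) s ` window N) \<le> k * (2 * N + 1)"
    using box[of 0 0 "fst s" "snd s"] unfolding W[symmetric] sW[symmetric] k_def by simp
  show "card ((+) s ` window N - window N) \<le> k * (2 * N + 1)"
    using box[of "fst s" "snd s" 0 0] unfolding W[symmetric] sW[symmetric] k_def by simp
qed

text \<open>
  A shift of the window changes the sum by boundary terms only: their number grows linearly
  with \<open>N\<close>, while each is of the order of \<open>1 / N\<^sup>2\<close>.
\<close>

lemma window_shift_tendsto_0:
  fixes g :: "complex \<Rightarrow> real"
  assumes "C \<ge> 0" and decay: "\<And>p. norm p \<ge> R \<Longrightarrow> \<bar>g p\<bar> \<le> C / (norm p)\<^sup>2"
  shows "(\<lambda>N. \<Sum>p\<in>window N. g (lattice_pt p) - g (lattice_pt p + lattice_pt s)) \<longlonglongrightarrow> 0"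
proof -
  define k where "k = nat \<bar>fst s\<bar> + nat \<bar>snd s\<bar>"
  have norm_s: "norm (lattice_pt s) \<le> real k"
    using cmod_le[of "lattice_pt s"] by (simp add: k_def lattice_pt_def)
  \<comment> \<open>For such \<open>N\<close>, every point in only one of the two windows has norm at least
    \<open>N / 2 \<ge> R\<close>.\<close>
  have bound: "\<bar>\<Sum>p\<in>window N. g (lattice_pt p) - g (lattice_pt p + lattice_pt s)\<bar> \<le> (24 * C * real k) / real N"
    if N: "real N \<ge> 2 * k + 2 * \<bar>R\<bar> + 1" for N
  proof -
    let ?W = "window N" and ?V = "(+) s ` window N" and ?G = "\<lambda>p. g (lattice_pt p)"
    have Npos: "real N \<ge> 1" using N by linarith
    have "(\<Sum>p\<in>?W. g (lattice_pt p + lattice_pt s)) = sum ?G ?V"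
      by (subst sum.reindex) (auto simp: lattice_pt_add add.commute)
    then have "(\<Sum>p\<in>?W. g (lattice_pt p) - g (lattice_pt p + lattice_pt s)) = sum ?G ?W - sum ?G ?V"
      by (simp add: sum_subtractf)
    also have "\<dots> = sum ?G (?W - ?V) - sum ?G (?V - ?W)"
      using sum.Int_Diff[of ?W ?G ?V] sum.Int_Diff[of ?V ?G ?W] by (simp add: Int_commute)
    finally have eq: "(\<Sum>p\<in>?W. g (lattice_pt p) - g (lattice_pt p + lattice_pt s)) =
       sum ?G (?W - ?V) - sum ?G (?V - ?W)" .
    have term_le: "\<bar>?G p\<bar> \<le> 4 * C / (real N)\<^sup>2" if "p \<in> (?W - ?V) \<union> (?V - ?W)" for p
    proof -
      have "norm (lattice_pt p) \<ge> real N / 2"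
      proof (cases "p \<in> ?W")
        case True
        then have "p - s \<notin> ?W" using that by (force simp: image_iff)
        then have "norm (lattice_pt p - lattice_pt s) > N"
          using norm_outside_window[of "p - s"] by (simp add: lattice_pt_diff)
        then show ?thesis using norm_s N norm_triangle_ineq4[of "lattice_pt p" "lattice_pt s"] by linarith
      next
        case False
        then show ?thesis using norm_outside_window[of p N] Npos by linarith
      qed
      moreover from this have "\<bar>?G p\<bar> \<le> C / (norm (lattice_pt p))\<^sup>2"
        using N by (intro decay) linarith
      moreover have "C / (norm (lattice_pt p))\<^sup>2 \<le> C / (real N / 2)\<^sup>2"
        using \<open>norm (lattice_pt p) \<ge> real N / 2\<close> Npos \<open>C \<ge> 0\<close>
        by (intro divide_left_mono power_mono mult_pos_pos) auto
      ultimately have "\<bar>?G p\<bar> \<le> C / (real N / 2)\<^sup>2" by linarith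
      then show ?thesis by (simp add: power2_eq_square mult.commute)
    qed
    have part: "\<bar>sum ?G A\<bar> \<le> 12 * C * real k / real N"
      if A: "A \<subseteq> (?W - ?V) \<union> (?V - ?W)" "card A \<le> k * (2 * N + 1)" for A
    proof -
      have "\<bar>sum ?G A\<bar> \<le> (\<Sum>p\<in>A. 4 * C / (real N)\<^sup>2)"
        using A(1) by (intro order_trans[OF sum_abs] sum_mono term_le) blast
      also have "\<dots> = real (card A) * (4 * C / (real N)\<^sup>2)" by simp
      also have "\<dots> \<le> (real k * (3 * real N)) * (4 * C / (real N)\<^sup>2)"
      proof (intro mult_right_mono)
        have "real (card A) \<le> real (k * (2 * N + 1))" using A(2) of_nat_le_iff by blast
        also have "\<dots> \<le> real k * (3 * real N)"
          unfolding of_nat_mult using Npos by (intro mult_left_mono) auto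
        finally show "real (card A) \<le> real k * (3 * real N)" .
      qed (use \<open>C \<ge> 0\<close> in auto)
      also have "\<dots> = 12 * C * real k / real N" using Npos by (simp add: power2_eq_square)
      finally show ?thesis by simp
    qed
    have "\<bar>sum ?G (?W - ?V)\<bar> \<le> 12 * C * real k / real N" "\<bar>sum ?G (?V - ?W)\<bar> \<le> 12 * C * real k / real N"
      by (rule part; use card_window_shift[where s=s and N=N] in \<open>auto simp: k_def\<close>)+
    then have "\<bar>sum ?G (?W - ?V) - sum ?G (?V - ?W)\<bar> \<le> 12 * C * real k / real N + 12 * C * real k / real N"
      by linarith
    also have "\<dots> = 24 * C * real k / real N" by (simp flip: add_divide_distrib)
    finally show ?thesis unfolding eq .
  qed
  have lim: "(\<lambda>N. (24 * C * real k) / real N) \<longlonglongrightarrow> 0" by (rule lim_const_over_n)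
  show ?thesis
  proof (rule Lim_null_comparison[OF _ lim])
    show "\<forall>\<^sub>F N in sequentially. norm (\<Sum>p\<in>window N. g (lattice_pt p) - g (lattice_pt p + lattice_pt s))
        \<le> (24 * C * real k) / real N"
      using eventually_ge_at_top[of "nat \<lceil>2 * k + 2 * \<bar>R\<bar> + 1\<rceil>"]
    proof eventually_elim
      case (elim N)
      then show ?case using bound[of N] unfolding nat_ceiling_le_eq real_norm_def by blast
    qed
  qed
qed

text \<open>
  By reflection in the midpoint, the sum of the angles over the points \<open>p - z\<close> is minus the sum
  over the points \<open>p + u + v + z\<close>. The same holds for \<open>z = 0\<close>; subtracting, one is left with a
  window shift of the function \<open>g\<close> below, which decays quadratically.
\<close>

lemma window_view_angle_tendsto_0:
  fixes a b :: "int \<times> int"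
  defines "u \<equiv> lattice_pt a" and "v \<equiv> lattice_pt b"
  shows "(\<lambda>N. \<Sum>p\<in>window N. view_angle (lattice_pt p + z) u v + view_angle (lattice_pt p - z) u v
      - 2 * view_angle (lattice_pt p) u v) \<longlonglongrightarrow> 0"
proof -
  obtain C R where C: "C \<ge> 0" "\<And>p. norm p \<ge> R \<Longrightarrow>
      \<bar>view_angle (p + z) u v - view_angle p u v\<bar> \<le> C / (norm p)\<^sup>2"
    using view_angle_far_variation by metis
  define g where "g p = view_angle (p + z) u v - view_angle p u v" for p
  define s where "s = a + b"
  have s: "lattice_pt s = u + v" by (simp add: s_def u_def v_def lattice_pt_add)
  have reflect: "(\<Sum>p\<in>window N. view_angle (lattice_pt p - y) u v) =
      - (\<Sum>p\<in>window N. view_angle (lattice_pt p + lattice_pt s + y) u v)" for N y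
  proof -
    have "(\<Sum>p\<in>window N. view_angle (lattice_pt p - y) u v) =
        (\<Sum>p\<in>window N. view_angle (- lattice_pt p - y) u v)"
      by (rule sum.reindex_bij_witness[of _ uminus uminus])
         (auto simp: lattice_pt_minus window_def)
    also have "\<dots> = (\<Sum>p\<in>window N. - view_angle (lattice_pt p + lattice_pt s + y) u v)"
    proof (intro sum.cong refl)
      fix p
      show "view_angle (- lattice_pt p - y) u v = - view_angle (lattice_pt p + lattice_pt s + y) u v"
      proof -
        have "u + v - (lattice_pt p + lattice_pt s + y) = - lattice_pt p - y" by (simp add: s)
        then show ?thesis
          using view_angle_point_reflection[of u v "lattice_pt p + lattice_pt s + y"] by (simp only:)
      qed
    qed
    finally show ?thesis by (simp add: sum_negf)
  qed
  have "(\<Sum>p\<in>window N. view_angle (lattice_pt p + z) u v + view_angle (lattice_pt p - z) u v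
      - 2 * view_angle (lattice_pt p) u v) =
    (\<Sum>p\<in>window N. g (lattice_pt p) - g (lattice_pt p + lattice_pt s))" for N
    using reflect[where N = N and y = z] reflect[where N = N and y = 0]
    by (simp add: g_def sum.distrib sum_subtractf sum_distrib_left[symmetric])
  then show ?thesis using window_shift_tendsto_0[OF C(1), of R g s] C(2) by (simp add: g_def)
qed

text \<open>
  For a single segment the sums over growing windows only converge to each other. For a sum \<open>T\<close>
  that vanishes outside a window they are eventually constant, so they agree.
\<close>

lemma lattice_sum_shift_invariant:
  fixes u v :: "'a \<Rightarrow> complex" and z :: complex and I :: "'a set"
  defines "T \<equiv> \<lambda>q. \<Sum>i\<in>I. view_angle q (u i) (v i)"
  assumes lattice: "\<And>i. i \<in> I \<Longrightarrow> u i \<in> lattice_points \<and> v i \<in> lattice_points"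
    and vanish: "\<And>p. p \<notin> window M \<Longrightarrow>
      T (lattice_pt p) = 0 \<and> T (lattice_pt p + z) = 0 \<and> T (lattice_pt p - z) = 0"
  shows "(\<Sum>p\<in>window M. T (lattice_pt p + z) + T (lattice_pt p - z)) = 2 * (\<Sum>p\<in>window M. T (lattice_pt p))"
proof -
  define D where "D p = T (lattice_pt p + z) + T (lattice_pt p - z) - 2 * T (lattice_pt p)" for p
  have "(\<lambda>N. \<Sum>p\<in>window N. view_angle (lattice_pt p + z) (u i) (v i) +
      view_angle (lattice_pt p - z) (u i) (v i) - 2 * view_angle (lattice_pt p) (u i) (v i)) \<longlonglongrightarrow> 0"
    if i: "i \<in> I" for i
  proof -
    obtain a b where "u i = lattice_pt a" "v i = lattice_pt b"
      using lattice[OF i] unfolding range_lattice_pt[symmetric] by blast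
    then show ?thesis using window_view_angle_tendsto_0[of z a b] by simp
  qed
  then have "(\<lambda>N. \<Sum>i\<in>I. \<Sum>p\<in>window N. view_angle (lattice_pt p + z) (u i) (v i) +
      view_angle (lattice_pt p - z) (u i) (v i) - 2 * view_angle (lattice_pt p) (u i) (v i)) \<longlonglongrightarrow> (\<Sum>i\<in>I. 0)"
    by (intro tendsto_sum)
  moreover have "(\<Sum>i\<in>I. \<Sum>p\<in>window N. view_angle (lattice_pt p + z) (u i) (v i) +
      view_angle (lattice_pt p - z) (u i) (v i) - 2 * view_angle (lattice_pt p) (u i) (v i)) =
      (\<Sum>p\<in>window N. D p)" for N
    by (subst sum.swap) (simp add: D_def T_def sum.distrib sum_subtractf sum_distrib_left)
  ultimately have "(\<lambda>N. \<Sum>p\<in>window N. D p) \<longlonglongrightarrow> 0" by simp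
  moreover have "\<forall>\<^sub>F N in sequentially. (\<Sum>p\<in>window N. D p) = (\<Sum>p\<in>window M. D p)"
    using eventually_ge_at_top[of M]
  proof eventually_elim
    case (elim N)
    show ?case using vanish window_mono[OF elim] by (intro sum.mono_neutral_right) (auto simp: D_def)
  qed
  then have "(\<lambda>N. \<Sum>p\<in>window N. D p) \<longlonglongrightarrow> (\<Sum>p\<in>window M. D p)" by (rule tendsto_eventually)
  ultimately have "(\<Sum>p\<in>window M. D p) = 0" by (metis LIMSEQ_unique)
  then show ?thesis by (simp add: D_def sum_subtractf sum_distrib_left)
qed

section \<open>Counterclockwise polygons\<close>

text \<open>
  The orientation enters only through the values of the total angle off the boundary, which are
  \<open>2 * pi\<close> times the winding numbers.
\<close>

locale ccw_simple_polygon = simple_polygon +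
  assumes total_angle_off_boundary:
    "q \<notin> \<Gamma> \<Longrightarrow> total_angle q = (if q \<in> inside \<Gamma> then 2 * pi else 0)"
begin

definition other_angle :: "nat set \<Rightarrow> complex \<Rightarrow> real" where
  "other_angle J q = (\<Sum>j\<in>{..<n} - J. view_angle q (w j) (w (Suc j)))"

lemma other_angle_near:
  assumes "\<And>j. j < n \<Longrightarrow> j \<notin> J \<Longrightarrow> p \<notin> seg j"
  shows "isCont (other_angle J) p"
    and "\<forall>\<^sub>F q in at p. \<forall>j\<in>{..<n} - J. q \<notin> seg j"
proof -
  show "isCont (other_angle J) p"
    unfolding other_angle_def using assms by (intro continuous_sum view_angle_continuous) auto
  have "open (- (\<Union>j\<in>{..<n} - J. seg j))" by (intro open_Compl closed_UN) auto
  moreover have "p \<in> - (\<Union>j\<in>{..<n} - J. seg j)" using assms by auto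
  ultimately show "\<forall>\<^sub>F q in at p. \<forall>j\<in>{..<n} - J. q \<notin> seg j"
    by (auto simp: eventually_at_topological)
qed

lemma total_angle_split:
  assumes "J \<subseteq> {..<n}"
  shows "total_angle q = other_angle J q + (\<Sum>j\<in>J. view_angle q (w j) (w (Suc j)))"
  unfolding total_angle_def other_angle_def
  using assms by (simp add: sum.subset_diff[of J "{..<n}"])

definition next_side :: "nat \<Rightarrow> nat" where
  "next_side i = (if Suc i = n then 0 else Suc i)"

lemma next_side: "i < n \<Longrightarrow> next_side i < n" "next_side i \<noteq> i" "w (next_side i) = w (Suc i)" "w (Suc (next_side i)) = w (Suc (Suc i))"
  using n3 w_n by (auto simp: next_side_def)

lemma sides_through_vertex:
  assumes "i < n" "j < n" "w (Suc i) \<in> seg j"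
  shows "j = i \<or> j = next_side i"
proof (rule ccontr)
  assume *: "\<not> (j = i \<or> j = next_side i)"
  consider "i < j" | "j < i" using * by linarith
  then show False
  proof cases
    case 1
    then show False
      using sides_meet[of i j "w (Suc i)"] assms * distinct_ends[of 0] n3
      by (auto simp: next_side_def split: if_splits)
  next
    case 2
    then show False
      using sides_meet[of j i "w (Suc i)"] assms * distinct_ends[of i] n3
      by (auto simp: next_side_def split: if_splits)
  qed
qed

lemma vertices_distinct:
  assumes "i < n" "j < n" "w (Suc i) = w (Suc j)"
  shows "i = j"
proof (rule ccontr)
  assume "i \<noteq> j"
  have "i = next_side j" using sides_through_vertex[of j i] assms \<open>i \<noteq> j\<close> by auto
  then have "w (Suc j) \<noteq> w (Suc i)" using distinct_ends[of i] assms next_side(3)[of j] by auto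
  then show False using assms by simp
qed

lemma side_relative_interior:
  assumes "i < n" "j < n" "p \<in> open_segment (w i) (w (Suc i))" "p \<in> seg j"
  shows "j = i"
proof (rule ccontr)
  assume ne: "j \<noteq> i"
  have p: "p \<in> seg i" "p \<noteq> w i" "p \<noteq> w (Suc i)" using assms by (auto simp: open_segment_def)
  consider "i < j" | "j < i" using ne by linarith
  then show False
  proof cases
    case 1
    then show False using sides_meet[of i j p] assms p by auto
  next
    case 2
    then show False using sides_meet[of j i p] assms p w_n n3 by (auto simp: Suc_diff_Suc)
  qed
qed

text \<open>
  The sides through the vertex contribute 0 at the vertex itself, so the total angle there is the
  limit \<open>\<rho> p\<close> of the other sides in \<open>boundary_angle\<close>, the interior angle.
\<close>

lemma total_angle_vertex:
  assumes i: "i < n"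
  shows "total_angle (w (Suc i)) = pi - turn i"
proof -
  let ?p = "w (Suc i)" and ?x = "w (Suc (Suc i))" and ?y = "w i"
  let ?J = "{i, next_side i}"
  have J: "?J \<subseteq> {..<n}" using i next_side(1) by auto
  have total: "total_angle q = other_angle ?J q + view_angle q ?p ?x + view_angle q ?y ?p" for q
    using total_angle_split[OF J] next_side[of i] i by simp
  have away: "?p \<notin> seg j" if "j < n" "j \<notin> ?J" for j
    using sides_through_vertex[OF i that(1)] that(2) by auto
  have near: "isCont (other_angle ?J) ?p" "\<forall>\<^sub>F q in at ?p. \<forall>j\<in>{..<n} - ?J. q \<notin> seg j"
    using other_angle_near[of ?J ?p] away by blast+
  have two_valued: "\<forall>\<^sub>F q in at ?p. q \<notin> closed_segment ?p ?x \<longrightarrow> q \<notin> closed_segment ?y ?p \<longrightarrow>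
      other_angle ?J q + view_angle q ?p ?x + view_angle q ?y ?p \<in> {0, 2 * pi}"
    using near(2)
  proof eventually_elim
    case (elim q)
    show ?case
    proof (intro impI)
      assume "q \<notin> closed_segment ?p ?x" "q \<notin> closed_segment ?y ?p"
      then have "q \<notin> \<Gamma>" using elim next_side[of i] by (auto simp: boundary_def)
      then show "other_angle ?J q + view_angle q ?p ?x + view_angle q ?y ?p \<in> {0, 2 * pi}"
        using total_angle_off_boundary[of q] total[of q] by auto
    qed
  qed
  have e: "edge i \<noteq> 0" "edge (Suc i) \<noteq> 0" using edge_nonzero i by auto
  have "(?y - ?p) / (?x - ?p) \<notin> \<real>\<^sub>\<ge>\<^sub>0"
  proof
    assume "(?y - ?p) / (?x - ?p) \<in> \<real>\<^sub>\<ge>\<^sub>0"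
    then obtain r where r: "r \<ge> 0" "- edge i / edge (Suc i) = of_real r"
      by (auto elim!: nonneg_Reals_cases simp: edge_def)
    then have "- edge i = of_real r * edge (Suc i)" using e by (simp add: field_simps)
    then have "edge i = - (of_real r * edge (Suc i))" by (metis minus_minus)
    then have "(1 - r / (1 + r)) *\<^sub>R edge i + (r / (1 + r)) *\<^sub>R edge (Suc i) = 0"
      using r(1) by (simp add: scaleR_conv_of_real field_simps) 
    then have "0 \<in> closed_segment (edge i) (edge (Suc i))"
      using r(1) by (auto simp: closed_segment_def intro!: exI[of _ "r / (1 + r)"])
    then show False using no_spike[OF i] by simp
  qed
  then have "other_angle ?J ?p = pi - Arg ((?x - ?p) / (?p - ?y))"
    using boundary_angle(1)[OF near(1) _ _ _ two_valued] e by (auto simp: edge_def)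
  then show ?thesis using total[of ?p] by (simp add: turn_def edge_def view_angle_def)
qed

text \<open>
  A point inside a side may be regarded as a vertex with a straight angle, because the angle of
  the side, seen from off the side, is the sum of the angles of its two parts. The bisector is then
  the left normal of the side.
\<close>

lemma side_point_structure:
  assumes i: "i < n" and p: "p \<in> open_segment (w i) (w (Suc i))"
  defines "\<nu> \<equiv> \<i> * sgn (edge i)"
  shows "total_angle p = pi"
    and "\<forall>\<^sub>F t in at_right 0. p + of_real t * \<nu> \<in> inside \<Gamma>"
    and "\<forall>\<^sub>F t in at_right 0. p + of_real t * (- \<nu>) \<notin> \<Gamma> \<union> inside \<Gamma>"
proof -
  let ?x = "w (Suc i)" and ?y = "w i" and ?J = "{i}"
  have J: "?J \<subseteq> {..<n}" using i by auto
  have pi': "p \<in> seg i" "p \<noteq> ?x" "p \<noteq> ?y" using p by (auto simp: open_segment_def)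
  have total: "total_angle q = other_angle ?J q + view_angle q p ?x + view_angle q ?y p"
    if "q \<notin> seg i" for q
    using total_angle_split[OF J] view_angle_split[OF pi'(1) that] by simp
  have parts: "closed_segment p ?x \<union> closed_segment ?y p = seg i"
    using Un_closed_segment[OF pi'(1)] by (simp add: Un_commute)
  have away: "p \<notin> seg j" if "j < n" "j \<notin> ?J" for j
    using side_relative_interior[OF i that(1) p] that(2) by auto
  have near: "isCont (other_angle ?J) p" "\<forall>\<^sub>F q in at p. \<forall>j\<in>{..<n} - ?J. q \<notin> seg j"
    using other_angle_near[of ?J p] away by blast+
  have two_valued: "\<forall>\<^sub>F q in at p. q \<notin> closed_segment p ?x \<longrightarrow> q \<notin> closed_segment ?y p \<longrightarrow>
      other_angle ?J q + view_angle q p ?x + view_angle q ?y p \<in> {0, 2 * pi}"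
    using near(2)
  proof eventually_elim
    case (elim q)
    show ?case
    proof (intro impI)
      assume "q \<notin> closed_segment p ?x" "q \<notin> closed_segment ?y p"
      then have q: "q \<notin> seg i" using parts by blast
      then have "q \<notin> \<Gamma>" using elim by (auto simp: boundary_def)
      then show "other_angle ?J q + view_angle q p ?x + view_angle q ?y p \<in> {0, 2 * pi}"
        using total_angle_off_boundary[of q] total[OF q] by auto
    qed
  qed
  obtain s where s: "0 < s" "s < 1" "p = (1 - s) *\<^sub>R ?y + s *\<^sub>R ?x"
    using p by (auto simp: in_segment)
  have xp: "?x - p = of_real (1 - s) * edge i" and yp: "?y - p = of_real (- s) * edge i"
    by (simp_all add: s(3) edge_def scaleR_conv_of_real algebra_simps)
  have e: "edge i \<noteq> 0" using edge_nonzero i by auto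
  have ratio: "(?y - p) / (?x - p) = of_real (- s / (1 - s))"
    unfolding xp yp using e s by simp
  have neg: "- s / (1 - s) < 0" using s by (simp add: divide_neg_pos)
  have no_spike': "(?y - p) / (?x - p) \<notin> \<real>\<^sub>\<ge>\<^sub>0"
    unfolding ratio nonneg_Reals_of_real_iff using neg by simp
  have "Arg2pi ((?y - p) / (?x - p)) = pi"
    unfolding ratio Arg2pi_of_real using neg by simp
  moreover have "sgn (?x - p) = sgn (edge i)"
  proof -
    have "sgn (of_real (1 - s) :: complex) = 1" unfolding sgn_of_real using s by simp
    then show ?thesis unfolding xp sgn_mult by simp
  qed
  ultimately have \<nu>: "sgn (?x - p) * cis (Arg2pi ((?y - p) / (?x - p)) / 2) = \<nu>"
    by (simp add: \<nu>_def)
  note local_picture = boundary_angle[OF near(1) pi'(2)[symmetric] pi'(3)[symmetric] no_spike' two_valued, unfolded \<nu>]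
  have "(?x - p) / (p - ?y) = of_real ((1 - s) / s)"
    unfolding minus_diff_eq[of ?y p, symmetric] xp yp using e s by simp
  moreover have "\<not> (1 - s) / s < 0" using s by (simp add: not_less)
  ultimately have "Arg ((?x - p) / (p - ?y)) = 0" by (simp only: Arg_of_real if_False)
  then have "other_angle ?J p = pi" using local_picture(1) by simp
  then show "total_angle p = pi"
    using total_angle_split[OF J, of p] pi'(1) by (simp add: view_angle_def)
  have pos: "\<forall>\<^sub>F t::real in at_right 0. t > 0" by (simp add: eventually_at_right_less)
  have off: "q \<notin> \<Gamma>" if "q \<notin> closed_segment p ?x" "q \<notin> closed_segment ?y p" "\<forall>j\<in>{..<n} - ?J. q \<notin> seg j" for q
    using that parts by (auto simp: boundary_def)
  have lim: "filterlim (\<lambda>t. p + of_real t * z) (at p) (at_right 0)" if "z \<noteq> 0" for z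
    unfolding filterlim_at using that
    by (auto intro!: tendsto_eq_intros eventually_mono[OF pos])
  have \<nu>0: "\<nu> \<noteq> 0" "- \<nu> \<noteq> 0" using e by (auto simp: \<nu>_def sgn_zero_iff)
  have near': "\<forall>\<^sub>F t in at_right 0. \<forall>j\<in>{..<n} - ?J. p + of_real t * z \<notin> seg j" if "z \<noteq> 0" for z
    using near(2) lim[OF that] unfolding filterlim_iff by blast
  show "\<forall>\<^sub>F t in at_right 0. p + of_real t * \<nu> \<in> inside \<Gamma>"
    using local_picture(2) near'[OF \<nu>0(1)]
  proof eventually_elim
    case (elim t)
    then have "p + of_real t * \<nu> \<notin> \<Gamma>" using off by blast
    moreover have "total_angle (p + of_real t * \<nu>) = 2 * pi"
      using elim total[of "p + of_real t * \<nu>"] parts by auto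
    ultimately show ?case using total_angle_off_boundary by (auto split: if_splits)
  qed
  show "\<forall>\<^sub>F t in at_right 0. p + of_real t * (- \<nu>) \<notin> \<Gamma> \<union> inside \<Gamma>"
    using local_picture(3) near'[OF \<nu>0(2)]
  proof eventually_elim
    case (elim t)
    then have "p + of_real t * (- \<nu>) \<notin> \<Gamma>" using off by blast
    moreover have "total_angle (p + of_real t * (- \<nu>)) = 0"
      using elim total[of "p + of_real t * (- \<nu>)"] parts by auto
    ultimately show ?case using total_angle_off_boundary by (auto split: if_splits)
  qed
qed

text \<open>
  Hopf's argument expresses the sum by the total angle at \<open>w 0\<close>, which is the interior angle there.
\<close>

lemma sum_turn: "(\<Sum>i<n. turn i) = 2 * pi"
proof -
  have "Suc (n - 1) = n" using n3 by simp
  then have "total_angle (w 0) = pi - turn (n - 1)"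
    using total_angle_vertex[of "n - 1"] n3 w_n by simp
  then show ?thesis using sum_turn_eq by simp
qed

text \<open>
  Of the two unit vectors orthogonal to the side, the right normal leads outside and the left
  normal leads inside.
\<close>

lemma outward_normal_side:
  assumes i: "i < n"
  shows "outward_normal (\<Gamma> \<union> inside \<Gamma>) (w i) (w (Suc i)) = - \<i> * sgn (edge i)"
  unfolding outward_normal_def
proof (rule the_equality)
  let ?N = "- \<i> * sgn (edge i)"
  have e: "edge i \<noteq> 0" using edge_nonzero i by auto
  have out: "\<forall>\<^sub>F t in at_right 0. x + t *\<^sub>R ?N \<notin> \<Gamma> \<union> inside \<Gamma>"
    if "x \<in> open_segment (w i) (w (Suc i))" for x
    using side_point_structure(3)[OF i that] by (simp add: scaleR_conv_of_real)
  have "inner (\<i> * sgn (edge i)) (edge i) = 0"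
    by (simp add: inner_complex_def sgn_div_norm)
  then show "norm ?N = 1 \<and> inner ?N (w (Suc i) - w i) = 0 \<and>
      (\<forall>x\<in>open_segment (w i) (w (Suc i)). \<forall>\<^sub>F t in at_right 0. x + t *\<^sub>R ?N \<notin> \<Gamma> \<union> inside \<Gamma>)"
    using out e by (simp add: norm_mult norm_sgn edge_def)
  fix m assume m: "norm m = 1 \<and> inner m (w (Suc i) - w i) = 0 \<and>
      (\<forall>x\<in>open_segment (w i) (w (Suc i)). \<forall>\<^sub>F t in at_right 0. x + t *\<^sub>R m \<notin> \<Gamma> \<union> inside \<Gamma>)"
  define r where "r = m / sgn (edge i)"
  have s0: "sgn (edge i) \<noteq> 0" using e by (simp add: sgn_zero_iff)
  have mr: "m = r * sgn (edge i)" using s0 by (simp add: r_def)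
  have "norm r = 1" using m e by (simp add: r_def norm_divide norm_sgn)
  moreover have "Re r = 0"
  proof -
    have "inner m (edge i) = Re r * norm (edge i)"
    proof -
      have "edge i = of_real (norm (edge i)) * sgn (edge i)" using e by (simp add: sgn_div_norm scaleR_conv_of_real)
      then have "inner m (edge i) = inner (r * sgn (edge i)) (of_real (norm (edge i)) * sgn (edge i))"
        using mr by metis
      also have "\<dots> = Re r * norm (edge i) * (norm (sgn (edge i)))\<^sup>2"
        unfolding cmod_power2 by (simp add: inner_complex_def power2_eq_square algebra_simps)
      finally show ?thesis using e by (simp add: norm_sgn)
    qed
    then show ?thesis using m e by (simp add: edge_def)
  qed
  ultimately have "\<bar>Im r\<bar> = 1" by (simp add: cmod_def)
  then have "r = \<i> \<or> r = - \<i>" using \<open>Re r = 0\<close> by (auto simp: complex_eq_iff)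
  moreover have "r \<noteq> \<i>"
  proof
    assume "r = \<i>"
    define x where "x = midpoint (w i) (w (Suc i))"
    have x: "x \<in> open_segment (w i) (w (Suc i))" using distinct_ends[OF i] by (simp add: x_def)
    have "\<forall>\<^sub>F t in at_right 0. x + t *\<^sub>R m \<notin> \<Gamma> \<union> inside \<Gamma>" using m x by blast
    moreover have "\<forall>\<^sub>F t in at_right 0. x + t *\<^sub>R m \<in> inside \<Gamma>"
      using side_point_structure(2)[OF i x] by (simp add: mr \<open>r = \<i>\<close> scaleR_conv_of_real)
    ultimately have "\<forall>\<^sub>F t::real in at_right 0. False" by eventually_elim auto
    then show False by simp
  qed
  ultimately show "m = ?N" using mr by auto
qed

lemma Arg_outward_normals:
  "i < n \<Longrightarrow> Arg (outward_normal (\<Gamma> \<union> inside \<Gamma>) (w (Suc i)) (w (Suc (Suc i))) /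
     outward_normal (\<Gamma> \<union> inside \<Gamma>) (w i) (w (Suc i))) = turn i"
proof -
  assume i: "i < n"
  have "outward_normal (\<Gamma> \<union> inside \<Gamma>) (w (Suc i)) (w (Suc (Suc i))) = - \<i> * sgn (edge (Suc i))"
    using outward_normal_side[of "next_side i"] next_side[of i] i by (simp add: edge_def)
  moreover have e: "edge i \<noteq> 0" "edge (Suc i) \<noteq> 0" using edge_nonzero i by auto
  have "(- \<i> * sgn (edge (Suc i))) / (- \<i> * sgn (edge i)) =
     of_real (norm (edge i) / norm (edge (Suc i))) * (edge (Suc i) / edge i)"
    using e by (simp add: sgn_div_norm scaleR_conv_of_real field_simps)
  ultimately show "Arg (outward_normal (\<Gamma> \<union> inside \<Gamma>) (w (Suc i)) (w (Suc (Suc i))) /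
     outward_normal (\<Gamma> \<union> inside \<Gamma>) (w i) (w (Suc i))) = turn i"
    using e by (simp only: outward_normal_side[OF i] turn_def) (simp only: Arg_times_of_real zero_less_divide_iff zero_less_norm_iff simp_thms)
qed

text \<open>
  A boundary point has the angle \<open>pi\<close>, diminished by the exterior angle if it is a vertex.
\<close>

lemma total_angle_cases:
  "total_angle q = 2 * pi * of_bool (q \<in> inside \<Gamma>) + pi * of_bool (q \<in> \<Gamma>) -
     (\<Sum>i<n. if w (Suc i) = q then turn i else 0)"
proof (cases "q \<in> \<Gamma>")
  case False
  have "w (Suc i) \<in> \<Gamma>" if "i < n" for i using that by (auto simp: boundary_def)
  then have "(\<Sum>i<n. if w (Suc i) = q then turn i else 0) = 0"
    using False by (intro sum.neutral) auto
  then show ?thesis using False total_angle_off_boundary[of q] by simp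
next
  case True
  then have not_inside: "q \<notin> inside \<Gamma>" using inside_no_overlap[of \<Gamma>] by blast
  show ?thesis
  proof (cases "\<exists>i<n. q = w (Suc i)")
    case True
    then obtain i where i: "i < n" "q = w (Suc i)" by blast
    have "(\<Sum>j<n. if w (Suc j) = q then turn j else 0) = (\<Sum>j<n. if j = i then turn j else 0)"
      using vertices_distinct i by (intro sum.cong) auto
    also have "\<dots> = turn i" using i by simp
    finally show ?thesis using total_angle_vertex[OF i(1)] i \<open>q \<in> \<Gamma>\<close> not_inside by simp
  next
    case False
    obtain j where j: "j < n" "q \<in> seg j" using \<open>q \<in> \<Gamma>\<close> by (auto simp: boundary_def)
    have "q \<noteq> w j"
    proof
      assume "q = w j"
      moreover have "w j = w (Suc (if j = 0 then n - 1 else j - 1))" using w_n n3 by auto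
      moreover have "(if j = 0 then n - 1 else j - 1) < n" using j(1) n3 by auto
      ultimately show False using False by blast
    qed
    moreover have "q \<noteq> w (Suc j)" using False j by blast
    ultimately have "q \<in> open_segment (w j) (w (Suc j))" using j by (simp add: open_segment_def)
    then have "total_angle q = pi" using side_point_structure(1)[OF j(1)] by simp
    moreover have "(\<Sum>i<n. if w (Suc i) = q then turn i else 0) = 0"
      using False by (intro sum.neutral) auto
    ultimately show ?thesis using \<open>q \<in> \<Gamma>\<close> not_inside by simp
  qed
qed

lemma sum_total_angle:
  assumes L: "finite L" "\<And>i. w i \<in> L"
  shows "(\<Sum>q\<in>L. total_angle q) = 2 * pi * (card (L \<inter> inside \<Gamma>) + card (L \<inter> \<Gamma>) / 2 - 1)"
proof -
  have "(\<Sum>q\<in>L. \<Sum>i<n. if w (Suc i) = q then turn i else 0) = (\<Sum>i<n. turn i)"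
    by (subst sum.swap) (use L in simp)
  moreover have "(\<Sum>q\<in>L. of_bool (q \<in> A) :: real) = card (L \<inter> A)" for A
    using L(1) by (simp add: sum.If_cases of_bool_def)
  ultimately show ?thesis
    by (simp add: total_angle_cases sum.distrib sum_subtractf sum_turn
        flip: sum_distrib_left) (simp add: algebra_simps)
qed

end

section \<open>Area as a sum over the lattice\<close>

definition square_corner :: complex where "square_corner = Complex (1/2) (1/2)"

lemma mem_unit_square: "z \<in> cbox (- square_corner) square_corner \<longleftrightarrow> \<bar>Re z\<bar> \<le> 1/2 \<and> \<bar>Im z\<bar> \<le> 1/2"
  by (auto simp: in_cbox_complex_iff square_corner_def)

lemma measure_by_unit_squares:
  assumes S: "S \<in> lmeasurable" and bound: "\<And>x. x \<in> S \<Longrightarrow> norm x \<le> real M"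
  shows "measure lebesgue S = (\<Sum>p\<in>window M. measure lebesgue (S \<inter> (+) (lattice_pt p) ` cbox (- square_corner) square_corner))"
proof -
  let ?Q = "\<lambda>p. (+) (lattice_pt p) ` cbox (- square_corner) square_corner"
  have Q: "z \<in> ?Q p \<longleftrightarrow> \<bar>Re z - of_int (fst p)\<bar> \<le> 1/2 \<and> \<bar>Im z - of_int (snd p)\<bar> \<le> 1/2" for z p
  proof -
    have "z \<in> ?Q p \<longleftrightarrow> z - lattice_pt p \<in> cbox (- square_corner) square_corner"
      by (auto simp: image_iff intro!: bexI[of _ "z - lattice_pt p"])
    then show ?thesis by (simp add: mem_unit_square lattice_pt_def)
  qed
  have meas: "?Q p \<in> lmeasurable" for p by (intro measurable_translation lmeasurable_cbox)
  have "S \<subseteq> (\<Union>p\<in>window M. ?Q p)"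
  proof
    fix z assume "z \<in> S"
    then have "\<bar>Re z\<bar> \<le> M" "\<bar>Im z\<bar> \<le> M"
      using bound[of z] abs_Re_le_cmod[of z] abs_Im_le_cmod[of z] by auto
    then have "(round (Re z), round (Im z)) \<in> window M"
    proof -
      have r: "\<bar>round x\<bar> \<le> int M" if "\<bar>x\<bar> \<le> real M" for x :: real
        using that round_mono[of x "of_int (int M)"] round_mono[of "of_int (- int M)" x]
        unfolding round_of_int by (simp add: abs_le_iff)
      show ?thesis
        using r[OF \<open>\<bar>Re z\<bar> \<le> M\<close>] r[OF \<open>\<bar>Im z\<bar> \<le> M\<close>]
        unfolding window_def mem_Times_iff atLeastAtMost_iff fst_conv snd_conv by linarith
    qed
    moreover have "z \<in> ?Q (round (Re z), round (Im z))"
      unfolding Q using of_int_round_abs_le[of "Re z"] of_int_round_abs_le[of "Im z"]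
      by (simp add: abs_minus_commute)
    ultimately show "z \<in> (\<Union>p\<in>window M. ?Q p)" by blast
  qed
  then have "S = (\<Union>p\<in>window M. S \<inter> ?Q p)" by auto
  moreover have "measure lebesgue (\<Union>p\<in>window M. S \<inter> ?Q p) = (\<Sum>p\<in>window M. measure lebesgue (S \<inter> ?Q p))"
  proof (rule measure_negligible_finite_Union_image)
    show "S \<inter> ?Q p \<in> lmeasurable" for p using S meas by (rule fmeasurable.Int)
    show "pairwise (\<lambda>p q. negligible (S \<inter> ?Q p \<inter> (S \<inter> ?Q q))) (window M)"
      unfolding pairwise_def
    proof (intro ballI impI)
      fix p q :: "int \<times> int" assume ne: "p \<noteq> q"
      let ?H = "\<lambda>k c. {x::complex. x \<bullet> k = c}"
      have H: "negligible (?H 1 a \<union> ?H \<i> b)" for a b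
        by (intro negligible_Un negligible_standard_hyperplane) (auto simp: Basis_complex_def)
      \<comment> \<open>A coordinate within \<open>1/2\<close> of two different integers is their mean, so squares meet in lines.\<close>
      have midpoint_of_integers: "x = (of_int a + of_int b) / 2"
        if "a \<noteq> b" "\<bar>x - of_int a\<bar> \<le> 1/2" "\<bar>x - of_int b\<bar> \<le> 1/2" for x :: real and a b :: int
      proof -
        have "a + 1 \<le> b \<or> b + 1 \<le> a" using that(1) by linarith
        then consider "real_of_int a + 1 \<le> of_int b" | "real_of_int b + 1 \<le> of_int a" by linarith
        moreover have "x - of_int a \<le> 1/2" "of_int a - x \<le> 1/2" "x - of_int b \<le> 1/2" "of_int b - x \<le> 1/2"
          using that(2,3) by linarith+
        ultimately have "x * 2 = of_int a + of_int b" by cases argo+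
        then show ?thesis by simp
      qed
      have "S \<inter> ?Q p \<inter> (S \<inter> ?Q q) \<subseteq>
         ?H 1 ((of_int (fst p) + of_int (fst q)) / 2) \<union> ?H \<i> ((of_int (snd p) + of_int (snd q)) / 2)"
      proof
        fix z assume "z \<in> S \<inter> ?Q p \<inter> (S \<inter> ?Q q)"
        then have z: "z \<in> ?Q p" "z \<in> ?Q q" by auto
        have "fst p \<noteq> fst q \<or> snd p \<noteq> snd q" using ne by (auto simp: prod_eq_iff)
        then show "z \<in> ?H 1 ((of_int (fst p) + of_int (fst q)) / 2) \<union> ?H \<i> ((of_int (snd p) + of_int (snd q)) / 2)"
          using z unfolding Q using midpoint_of_integers[of "fst p" "fst q" "Re z"] midpoint_of_integers[of "snd p" "snd q" "Im z"]
          by (auto simp: inner_complex_def)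
      qed
      then show "negligible (S \<inter> ?Q p \<inter> (S \<inter> ?Q q))" using H negligible_subset by blast
    qed
  qed auto
  ultimately show ?thesis by simp
qed

lemma has_integral_translated_indicator:
  fixes a h :: complex
  assumes "S \<in> lmeasurable"
  shows "((\<lambda>z. indicator S (a + z) :: real) has_integral measure lebesgue (S \<inter> (+) a ` cbox (- h) h)) (cbox (- h) h)"
    and "((\<lambda>z. indicator S (a - z) :: real) has_integral measure lebesgue (S \<inter> (+) a ` cbox (- h) h)) (cbox (- h) h)"
proof -
  let ?T = "S \<inter> (+) a ` cbox (- h) h"
  have T: "?T \<in> lmeasurable"
    using assms by (intro fmeasurable.Int measurable_translation lmeasurable_cbox)
  then have "(+) (- a) ` ?T \<in> lmeasurable" by (rule measurable_translation)
  then have "(indicat_real ((+) (- a) ` ?T) has_integral measure lebesgue ?T) UNIV"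
    unfolding lmeasurable_iff_has_integral measure_translation .
  moreover have "z \<in> (+) (- a) ` ?T \<longleftrightarrow> z \<in> cbox (- h) h \<and> a + z \<in> S" for z
    by (auto simp: image_iff intro!: bexI[of _ "a + z"])
  then have "indicat_real ((+) (- a) ` ?T) = (\<lambda>z. if z \<in> cbox (- h) h then indicator S (a + z) else 0)"
    by (simp add: fun_eq_iff indicator_def del: image_iff)
  ultimately show *: "((\<lambda>z. indicator S (a + z) :: real) has_integral measure lebesgue ?T) (cbox (- h) h)"
    by (simp add: has_integral_restrict_UNIV)
  then show "((\<lambda>z. indicator S (a - z) :: real) has_integral measure lebesgue ?T) (cbox (- h) h)"
    using has_integral_reflect[of "\<lambda>z. indicator S (a + z) :: real" "measure lebesgue ?T" h "- h"] by simp
qed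

lemma negligible_closed_segment: "negligible (closed_segment u (v::complex))"
proof -
  have "frontier (closed_segment u v) = closed_segment u v"
    by (simp add: frontier_def interior_closed_segment_ge2)
  then show ?thesis using negligible_convex_frontier[of "closed_segment u v"] by simp
qed

text \<open>
  Up to a null set, the points \<open>p + z\<close> with \<open>z\<close> in the unit square cover the plane once, and so do
  the points \<open>p - z\<close>. Hence the integral over the unit square of the left side of the assumption
  \<open>shift\<close> is twice the measure of \<open>S\<close>, while that left side is constant.
\<close>

lemma measure_eq_lattice_sum:
  fixes f :: "complex \<Rightarrow> real"
  assumes S: "S \<in> lmeasurable" and bound: "\<And>x. x \<in> S \<Longrightarrow> norm x \<le> real M"
    and N: "negligible N" and f: "\<And>q. q \<notin> N \<Longrightarrow> f q = indicator S q"
    and shift: "\<And>z. z \<in> cbox (- square_corner) square_corner \<Longrightarrow>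
      (\<Sum>p\<in>window M. f (lattice_pt p + z) + f (lattice_pt p - z)) = 2 * (\<Sum>p\<in>window M. f (lattice_pt p))"
  shows "measure lebesgue S = (\<Sum>p\<in>window M. f (lattice_pt p))"
proof -
  let ?Q = "cbox (- square_corner) square_corner"
  define F where "F z = (\<Sum>p\<in>window M. indicator S (lattice_pt p + z) + indicator S (lattice_pt p - z) :: real)" for z
  let ?c = "2 * (\<Sum>p\<in>window M. f (lattice_pt p))"
  have "(F has_integral (\<Sum>p\<in>window M. measure lebesgue (S \<inter> (+) (lattice_pt p) ` ?Q) +
      measure lebesgue (S \<inter> (+) (lattice_pt p) ` ?Q))) ?Q"
    unfolding F_def by (intro has_integral_sum has_integral_add has_integral_translated_indicator S) auto
  moreover have "(\<Sum>p\<in>window M. measure lebesgue (S \<inter> (+) (lattice_pt p) ` ?Q) +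
      measure lebesgue (S \<inter> (+) (lattice_pt p) ` ?Q)) = 2 * measure lebesgue S"
  proof -
    have "(\<Sum>p\<in>window M. measure lebesgue (S \<inter> (+) (lattice_pt p) ` ?Q)) = measure lebesgue S"
      by (rule measure_by_unit_squares[OF S, symmetric]) (rule bound)
    then show ?thesis unfolding sum.distrib by simp
  qed
  ultimately have F: "(F has_integral 2 * measure lebesgue S) ?Q" by metis
  define E where "E = (\<Union>p\<in>window M. (+) (- lattice_pt p) ` N \<union> uminus ` (+) (- lattice_pt p) ` N)"
  have reflected: "negligible (uminus ` A)" if "negligible A" for A :: "complex set"
  proof -
    have "(uminus :: complex \<Rightarrow> complex) differentiable_on A"
      by (rule linear_imp_differentiable_on) (simp add: linear_uminus)
    then show ?thesis
      using that negligible_differentiable_image_negligible[where f = "uminus :: complex \<Rightarrow> complex"] by blast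
  qed
  have "negligible ((+) (- lattice_pt p) ` N \<union> uminus ` (+) (- lattice_pt p) ` N)" for p
    by (intro negligible_Un reflected negligible_translation N)
  then have E: "negligible E"
    unfolding E_def by (intro negligible_Union finite_imageI finite_window) blast
  have "F z = ?c" if z: "z \<in> ?Q - E" for z
  proof -
    have "lattice_pt p + z \<notin> N \<and> lattice_pt p - z \<notin> N" if "p \<in> window M" for p
    proof (intro conjI notI)
      assume "lattice_pt p + z \<in> N"
      then have "z \<in> (+) (- lattice_pt p) ` N" by (auto simp: image_iff intro!: bexI[of _ "lattice_pt p + z"])
      then show False using z that by (auto simp: E_def)
    next
      assume "lattice_pt p - z \<in> N"
      then have "z \<in> uminus ` (+) (- lattice_pt p) ` N"
        unfolding image_image by (auto simp: image_iff intro!: bexI[of _ "lattice_pt p - z"])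
      then show False using z that unfolding E_def by blast
    qed
    then have "F z = (\<Sum>p\<in>window M. f (lattice_pt p + z) + f (lattice_pt p - z))"
      unfolding F_def by (intro sum.cong) (auto simp: f)
    then show ?thesis using shift z by auto
  qed
  then have "((\<lambda>z. ?c) has_integral 2 * measure lebesgue S) ?Q"
    by (intro has_integral_spike[OF E _ F]) simp
  moreover have "((\<lambda>z. ?c) has_integral measure lborel ?Q *\<^sub>R ?c) ?Q" by (rule has_integral_const)
  moreover have "measure lborel ?Q = 1"
    by (subst content_cbox) (auto simp: Basis_complex_def square_corner_def)
  ultimately have "2 * measure lebesgue S = 1 *\<^sub>R ?c" using has_integral_unique by metis
  then show ?thesis by simp
qed

section \<open>Pick's formula and the rotation number\<close>

context ccw_simple_polygon
begin

lemma closed_boundary: "closed \<Gamma>" and bounded_boundary: "bounded \<Gamma>"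
  unfolding boundary_def by (auto intro!: closed_UN bounded_UN simp: bounded_closed_segment)

text \<open>
  The margin of 1 in the choice of the window ensures that no lattice point outside it is moved
  into the polygon by a vector of the unit square.
\<close>

lemma pick_formula:
  assumes lattice: "\<And>i. w i \<in> lattice_points"
  shows "finite (\<Gamma> \<inter> lattice_points)"
    and "measure lebesgue (\<Gamma> \<union> inside \<Gamma>) =
      card (inside \<Gamma> \<inter> lattice_points) + card (\<Gamma> \<inter> lattice_points) / 2 - 1"
proof -
  let ?P = "\<Gamma> \<union> inside \<Gamma>"
  have bdd: "bounded ?P" using bounded_boundary by (simp add: bounded_inside)
  have P: "?P \<in> lmeasurable"
  proof (rule lmeasurable_compact)
    have "closed ?P"
      unfolding union_with_inside using open_outside[OF closed_boundary] by (simp add: closed_Compl)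
    then show "compact ?P" using bdd by (simp add: compact_eq_bounded_closed)
  qed
  obtain B where B: "\<And>x. x \<in> ?P \<Longrightarrow> norm x \<le> B" using bdd unfolding bounded_iff by blast
  define M where "M = nat \<lceil>B + 1\<rceil>"
  have M1: "norm x + 1 \<le> real M" if "x \<in> ?P" for x
    using B[OF that] unfolding M_def by linarith
  then have M: "norm x \<le> real M" if "x \<in> ?P" for x using that by force
  let ?L = "lattice_pt ` window M"
  have cut: "?L \<inter> A = A \<inter> lattice_points" if "A \<subseteq> ?P" for A
  proof
    show "A \<inter> lattice_points \<subseteq> ?L \<inter> A"
    proof
      fix x assume x: "x \<in> A \<inter> lattice_points"
      then obtain p where p: "x = lattice_pt p" unfolding range_lattice_pt[symmetric] by blast
      have "norm x \<le> real M" using x that M by blast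
      then have "p \<in> window M" using norm_outside_window[of p M] p by force
      then show "x \<in> ?L \<inter> A" using p x by blast
    qed
  qed (auto simp flip: range_lattice_pt)
  have vanish: "total_angle q = 0" if "q \<notin> ?P" for q
    using total_angle_off_boundary[of q] that by auto
  have shift: "(\<Sum>p\<in>window M. total_angle (lattice_pt p + z) + total_angle (lattice_pt p - z)) =
      2 * (\<Sum>p\<in>window M. total_angle (lattice_pt p))" if z: "z \<in> cbox (- square_corner) square_corner" for z
    unfolding total_angle_def
  proof (rule lattice_sum_shift_invariant)
    fix p assume p: "p \<notin> window M"
    have "norm z \<le> 1" using cmod_le[of z] z unfolding mem_unit_square by linarith
    then have "norm (lattice_pt p + y) > real M - 1" if "y \<in> {0, z, - z}" for y
      using that norm_outside_window[OF p] norm_diff_ineq[of "lattice_pt p" y] by auto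
    then have "lattice_pt p + y \<notin> ?P" if "y \<in> {0, z, - z}" for y
      using M1[of "lattice_pt p + y"] that by force
    then have "total_angle (lattice_pt p + y) = 0" if "y \<in> {0, z, - z}" for y
      using vanish that by blast
    from this[of 0] this[of z] this[of "- z"]
    show "(\<Sum>i<n. view_angle (lattice_pt p) (w i) (w (Suc i))) = 0 \<and>
       (\<Sum>i<n. view_angle (lattice_pt p + z) (w i) (w (Suc i))) = 0 \<and>
       (\<Sum>i<n. view_angle (lattice_pt p - z) (w i) (w (Suc i))) = 0"
      by (simp add: total_angle_def)
  qed (use lattice in auto)
  have "negligible \<Gamma>"
    unfolding boundary_def by (intro negligible_Union) (auto simp: negligible_closed_segment)
  moreover have "total_angle q / (2 * pi) = indicator ?P q" if "q \<notin> \<Gamma>" for q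
    using total_angle_off_boundary[OF that] that by simp
  ultimately have "measure lebesgue ?P = (\<Sum>p\<in>window M. total_angle (lattice_pt p) / (2 * pi))"
    using shift M by (intro measure_eq_lattice_sum[where N = \<Gamma>] P)
      (auto simp flip: sum_divide_distrib add_divide_distrib)
  also have "\<dots> = (\<Sum>q\<in>?L. total_angle q) / (2 * pi)"
    by (simp add: sum.reindex inj_on_subset[OF inj_lattice_pt] sum_divide_distrib)
  also have "(\<Sum>q\<in>?L. total_angle q) = 2 * pi * (card (?L \<inter> inside \<Gamma>) + card (?L \<inter> \<Gamma>) / 2 - 1)"
  proof (rule sum_total_angle)
    fix i
    have "i mod n < n" using n3 by simp
    then have "w i \<in> \<Gamma>" unfolding boundary_def using w_mod[of i] by (metis UN_I ends_in_segment(1) lessThan_iff)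
    then show "w i \<in> ?L" using cut[of \<Gamma>] lattice by blast
  qed simp
  finally show "measure lebesgue ?P = card (inside \<Gamma> \<inter> lattice_points) + card (\<Gamma> \<inter> lattice_points) / 2 - 1"
    using cut[of \<Gamma>] cut[of "inside \<Gamma>"] by simp
  show "finite (\<Gamma> \<inter> lattice_points)"
    using cut[of \<Gamma>] finite_imageI[OF finite_window, of lattice_pt M]
    by (metis finite_Int Un_upper1)
qed

lemma three_boundary_lattice_points:
  assumes "\<And>i. w i \<in> lattice_points"
  shows "card (\<Gamma> \<inter> lattice_points) \<ge> 3"
proof -
  have "inj_on (\<lambda>i. w (Suc i)) {..<n}" using vertices_distinct by (auto simp: inj_on_def)
  then have "card ((\<lambda>i. w (Suc i)) ` {..<n}) = n" by (simp add: card_image)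
  moreover have "(\<lambda>i. w (Suc i)) ` {..<n} \<subseteq> \<Gamma> \<inter> lattice_points"
    using assms by (auto simp: boundary_def)
  ultimately show ?thesis using pick_formula(1)[OF assms] n3 by (metis card_mono le_trans)
qed

end

lemma simple_polygon_vertices:
  assumes "length vs \<ge> 3" "simple_path (closed_polygonal_path vs)"
  shows "simple_polygon (length vs) (vertex vs)"
proof
  show "vertex vs (i + length vs) = vertex vs i" for i by (simp add: vertex_def)
qed (use assms simple_closed_polygonal_path_iff[OF assms(1)] in blast)+

lemma ccw_simple_polygon_vertices:
  assumes "ccw_vertices P vs"
  shows "ccw_simple_polygon (length vs) (vertex vs)"
    and "simple_polygon.boundary (length vs) (vertex vs) = path_image (closed_polygonal_path vs)"
proof -
  have vs: "length vs \<ge> 3" "simple_path (closed_polygonal_path vs)"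
    using assms by (auto simp: ccw_vertices_def polygon_vertices_def)
  interpret simple_polygon "length vs" "vertex vs" by (rule simple_polygon_vertices[OF vs])
  note basics = closed_polygonal_path_basics[OF vs(1)]
  show image: "boundary = path_image (closed_polygonal_path vs)"
    unfolding basics(3) boundary_def ..
  show "ccw_simple_polygon (length vs) (vertex vs)"
  proof
    fix q assume q: "q \<notin> boundary"
    have "total_angle q = 2 * pi * Re (winding_number (closed_polygonal_path vs) q)"
      using winding_number_closed_polygonal_path[OF vs(1)] q unfolding total_angle_def image by simp
    also have "winding_number (closed_polygonal_path vs) q = (if q \<in> inside boundary then 1 else 0)"
    proof (cases "q \<in> inside boundary")
      case True
      then show ?thesis using assms by (simp add: ccw_vertices_def image)
    next
      case False
      then have "q \<in> outside (path_image (closed_polygonal_path vs))"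
        using q unfolding image using inside_Un_outside by blast
      then show ?thesis
        using False winding_number_zero_in_outside basics(1) vs(2) by (simp add: simple_path_imp_path)
    qed
    finally show "total_angle q = (if q \<in> inside boundary then 2 * pi else 0)" by auto
  qed
qed

text \<open>
  Reversing the list and keeping its first element traverses the same sides backwards, so each
  side is seen under the opposite angle.
\<close>

lemma reversed_polygon:
  fixes vs :: "complex list"
  assumes len: "length vs \<ge> 3" and simple: "simple_path (closed_polygonal_path vs)"
  defines "us \<equiv> rev (rotate1 vs)"
  shows "simple_path (closed_polygonal_path us)"
    and "path_image (closed_polygonal_path us) = path_image (closed_polygonal_path vs)"
    and "q \<notin> path_image (closed_polygonal_path vs) \<Longrightarrow>
      Re (winding_number (closed_polygonal_path us) q) = - Re (winding_number (closed_polygonal_path vs) q)"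
proof -
  let ?n = "length vs"
  have ne: "vs \<noteq> []" "us \<noteq> []" and len_us: "length us = ?n" "length us \<ge> 3"
    using len by (auto simp: us_def)
  have vertex_us: "vertex us i = vertex vs (?n - i)" if "i \<le> ?n" for i
  proof -
    have "us @ [hd us] = rev (vs @ [hd vs])" using ne(1) by (cases vs) (auto simp: us_def)
    then have "vertex us i = rev (vs @ [hd vs]) ! i"
      using closing_list_nth[OF ne(2)] that len_us by simp
    also have "\<dots> = (vs @ [hd vs]) ! (?n - i)" using that by (subst rev_nth) auto
    finally show ?thesis using closing_list_nth[OF ne(1)] by simp
  qed
  have backwards: "vertex us i = vertex vs (Suc (?n - Suc i))" "vertex us (Suc i) = vertex vs (?n - Suc i)"
    if "i < ?n" for i
    using vertex_us[of i] vertex_us[of "Suc i"] that by (simp_all add: Suc_diff_Suc)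
  interpret simple_polygon ?n "vertex vs" by (rule simple_polygon_vertices[OF len simple])
  show "simple_path (closed_polygonal_path us)"
    unfolding simple_closed_polygonal_path_iff[OF len_us(2)] len_us(1)
  proof (intro conjI allI impI)
    fix i assume "i < ?n"
    then show "vertex us i \<noteq> vertex us (Suc i)"
      using distinct_ends[of "?n - Suc i"] backwards[of i] by (simp add: eq_commute)
  next
    fix i j z
    assume ij: "i < j" "j < ?n" and z: "z \<in> closed_segment (vertex us i) (vertex us (Suc i))"
      "z \<in> closed_segment (vertex us j) (vertex us (Suc j))"
    have "z \<in> seg (?n - Suc i)" "z \<in> seg (?n - Suc j)"
      using z backwards[of i] backwards[of j] ij by (simp_all add: closed_segment_commute)
    then have "(?n - Suc i = Suc (?n - Suc j) \<and> z = vertex vs (?n - Suc i)) \<or>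
        (?n - Suc j = 0 \<and> ?n - Suc i = ?n - 1 \<and> z = vertex vs 0)"
      using ij by (intro sides_meet) auto
    then show "(j = Suc i \<and> z = vertex us j) \<or> (i = 0 \<and> j = ?n - 1 \<and> z = vertex us 0)"
    proof
      assume *: "?n - Suc i = Suc (?n - Suc j) \<and> z = vertex vs (?n - Suc i)"
      then have "j = Suc i" using ij by linarith
      then show ?thesis using * vertex_us[of j] ij by simp
    next
      assume *: "?n - Suc j = 0 \<and> ?n - Suc i = ?n - 1 \<and> z = vertex vs 0"
      then have "i = 0" "j = ?n - 1" using ij by linarith+
      then show ?thesis using * vertex_us[of 0] w_n by simp
    qed
  qed
  have reindex: "{..<?n} = (\<lambda>i. ?n - Suc i) ` {..<?n}"
  proof -
    have "i \<in> (\<lambda>i. ?n - Suc i) ` {..<?n}" if "i < ?n" for i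
      using that by (intro image_eqI[of _ _ "?n - Suc i"]) auto
    then show ?thesis by auto
  qed
  show image: "path_image (closed_polygonal_path us) = path_image (closed_polygonal_path vs)"
  proof -
    have "path_image (closed_polygonal_path us) = (\<Union>i<?n. seg (?n - Suc i))"
      unfolding closed_polygonal_path_basics(3)[OF len_us(2)] len_us(1)
      by (intro SUP_cong) (simp_all add: backwards closed_segment_commute)
    also have "\<dots> = (\<Union>i\<in>(\<lambda>i. ?n - Suc i) ` {..<?n}. seg i)" by simp
    finally show ?thesis unfolding closed_polygonal_path_basics(3)[OF len] reindex[symmetric] .
  qed
  show "Re (winding_number (closed_polygonal_path us) q) = - Re (winding_number (closed_polygonal_path vs) q)"
    if q: "q \<notin> path_image (closed_polygonal_path vs)"
  proof -
    have "2 * pi * Re (winding_number (closed_polygonal_path us) q) =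
        (\<Sum>i<?n. view_angle q (vertex us i) (vertex us (Suc i)))"
      using winding_number_closed_polygonal_path[OF len_us(2)] q image len_us(1) by simp
    also have "\<dots> = (\<Sum>i<?n. - view_angle q (vertex vs (?n - Suc i)) (vertex vs (Suc (?n - Suc i))))"
      by (intro sum.cong refl) (simp only: lessThan_iff backwards, rule view_angle_swap)
    also have "\<dots> = - (\<Sum>i<?n. view_angle q (vertex vs i) (vertex vs (Suc i)))"
      unfolding sum_negf
      using sum.nat_diff_reindex[of "\<lambda>i. view_angle q (vertex vs i) (vertex vs (Suc i))" ?n] by simp
    also have "\<dots> = - (2 * pi * Re (winding_number (closed_polygonal_path vs) q))"
      using winding_number_closed_polygonal_path[OF len q] by simp
    finally have "2 * pi * Re (winding_number (closed_polygonal_path us) q) =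
        2 * pi * (- Re (winding_number (closed_polygonal_path vs) q))" by simp
    then show ?thesis by (rule mult_left_cancel[THEN iffD1, rotated]) simp
  qed
qed

lemma ccw_vertices_exist:
  assumes "polygon_vertices P vs"
  obtains us where "ccw_vertices P us"
proof -
  have len: "length vs \<ge> 3" and simple: "simple_path (closed_polygonal_path vs)"
    using assms by (auto simp: polygon_vertices_def)
  let ?us = "rev (rotate1 vs)"
  note reversed = reversed_polygon[OF len simple]
  from simple show thesis
  proof (cases rule: simple_closed_path_winding_number_inside)
    case 1
    then show thesis using assms that unfolding ccw_vertices_def by blast
  next
    case 2
    have polygon: "polygon_vertices P ?us"
      using assms reversed(1,2) by (simp add: polygon_vertices_def)
    have "winding_number (closed_polygonal_path ?us) z = 1"
      if z: "z \<in> inside (path_image (closed_polygonal_path ?us))" for z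
    proof -
      have z': "z \<notin> path_image (closed_polygonal_path vs)" "z \<in> inside (path_image (closed_polygonal_path vs))"
        using z inside_no_overlap unfolding reversed(2) by blast+
      have "Re (winding_number (closed_polygonal_path ?us) z) = 1"
        using reversed(3)[OF z'(1)] 2[OF z'(2)] by simp
      moreover have "z \<notin> path_image (closed_polygonal_path ?us)" using z inside_no_overlap by blast
      then have "winding_number (closed_polygonal_path ?us) z \<in> {-1, 0, 1}"
        using reversed(1) len closed_polygonal_path_basics(1)[of ?us]
        by (intro simple_closed_path_winding_number_cases) auto
      ultimately show ?thesis by auto
    qed
    then show thesis using that polygon unfolding ccw_vertices_def by blast
  qed
qed

text \<open>
  The region is the complement of the outside, whose frontier is the whole curve by the Jordan
  curve theorem.
\<close>

lemma polygon_region: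
  assumes "polygon_vertices P vs"
  defines "G \<equiv> path_image (closed_polygonal_path vs)"
  shows "frontier P = G" "interior P = inside G"
proof -
  have len: "length vs \<ge> 3" and simple: "simple_path (closed_polygonal_path vs)"
    and P: "P = G \<union> inside G"
    using assms by (auto simp: polygon_vertices_def)
  note jordan = Jordan_inside_outside[OF simple closed_polygonal_path_basics(1)[OF len], folded G_def]
  have P': "P = - outside G" unfolding P using inside_Un_outside[of G] inside_Int_outside[of G] outside_no_overlap[of G] by blast
  show frontier: "frontier P = G" unfolding P' frontier_complement using jordan by blast
  have "closed P" unfolding P' using jordan by blast
  then have "interior P = P - G" using frontier frontier_def closure_closed interior_subset by (metis Diff_Diff_Int inf.absorb_iff2)
  then show "interior P = inside G" unfolding P using inside_no_overlap[of G] by blast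
qed

lemma lattice_polygon_rotation_number:
  assumes "lattice_polygon P"
  shows "rotation_number P = 1"
proof -
  obtain us where "ccw_vertices P us" using assms ccw_vertices_exist unfolding lattice_polygon_def by blast
  moreover define vs where "vs = (SOME vs. ccw_vertices P vs)"
  ultimately have ccw: "ccw_vertices P vs" by (auto intro: someI)
  interpret ccw_simple_polygon "length vs" "vertex vs" by (rule ccw_simple_polygon_vertices(1)[OF ccw])
  have P: "P = boundary \<union> inside boundary"
    using ccw_simple_polygon_vertices(2)[OF ccw] ccw by (simp add: ccw_vertices_def polygon_vertices_def)
  have "side_normal P vs i = outward_normal (boundary \<union> inside boundary) (vertex vs i) (vertex vs (Suc i))" for i
    by (simp add: side_normal_def vertex_def P)
  then have "normals_rotation P vs = (\<Sum>i<length vs. turn i) / (2 * pi)"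
    unfolding normals_rotation_def by (simp add: Arg_outward_normals)
  then show ?thesis using sum_turn by (simp add: rotation_number_def vs_def)
qed

lemma pick_theorem:
  assumes "lattice_polygon P"
  shows "polygon_area P = card (interior P \<inter> lattice_points) + boundary_count P / 2 - 1"
    and "boundary_count P \<ge> 3"
proof -
  obtain vs where ccw: "ccw_vertices P vs" using assms ccw_vertices_exist unfolding lattice_polygon_def by blast
  then have vs: "polygon_vertices P vs" by (simp add: ccw_vertices_def)
  interpret ccw_simple_polygon "length vs" "vertex vs" by (rule ccw_simple_polygon_vertices(1)[OF ccw])
  have image: "boundary = path_image (closed_polygonal_path vs)" by (rule ccw_simple_polygon_vertices(2)[OF ccw])
  have P: "P = boundary \<union> inside boundary" "frontier P = boundary" "interior P = inside boundary"
    using vs polygon_region[OF vs] by (simp_all add: image polygon_vertices_def)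
  have "vertex vs i \<in> lattice_points" for i
  proof -
    have "i mod length vs < length vs" using n3 by (intro mod_less_divisor) linarith
    then show ?thesis using vs by (auto simp: vertex_def polygon_vertices_def)
  qed
  note pick = pick_formula[OF this] and three = three_boundary_lattice_points[OF this]
  show "polygon_area P = card (interior P \<inter> lattice_points) + boundary_count P / 2 - 1"
    using pick(2) unfolding polygon_area_def boundary_count_def P(2,3) P(1)[symmetric] .
  show "boundary_count P \<ge> 3" using three unfolding boundary_count_def P(2) .
qed

section \<open>Polygons with prescribed numbers of lattice points\<close>

lemma ray_outside:
  fixes z d :: complex
  assumes "d \<noteq> 0" and ray: "\<And>t. t \<ge> 0 \<Longrightarrow> z + of_real t * d \<notin> S"
  shows "z \<in> outside S"
proof -
  define R where "R = (\<lambda>t::real. z + of_real t * d) ` {0..}"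
  have "connected R"
    unfolding R_def by (intro connected_continuous_image continuous_intros) auto
  moreover have "z \<in> R" unfolding R_def by (intro image_eqI[of _ _ 0]) auto
  moreover have "R \<subseteq> - S" using ray by (auto simp: R_def)
  ultimately have sub: "R \<subseteq> connected_component_set (- S) z" by (intro connected_component_maximal)
  have "\<not> bounded R"
  proof
    assume "bounded R"
    then obtain B where B: "\<And>x. x \<in> R \<Longrightarrow> norm x \<le> B" unfolding bounded_iff by blast
    define t where "t = (\<bar>B\<bar> + norm z + 1) / norm d"
    have t: "t \<ge> 0" "t * norm d = \<bar>B\<bar> + norm z + 1" using assms(1) by (auto simp: t_def)
    have "norm (of_real t * d) = \<bar>B\<bar> + norm z + 1" using t by (simp add: norm_mult)
    then have "norm (z + of_real t * d) \<ge> \<bar>B\<bar> + 1"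
      using norm_triangle_ineq2[of "of_real t * d" "- z"] by (simp add: add.commute)
    moreover have "norm (z + of_real t * d) \<le> B" using t(1) by (intro B) (auto simp: R_def)
    ultimately show False by linarith
  qed
  then have "\<not> bounded (connected_component_set (- S) z)" using sub bounded_subset by blast
  moreover have "z \<notin> S" using ray[of 0] by simp
  ultimately show ?thesis by (simp add: outside_def)
qed

lemma view_angle_cross:
  assumes "q \<notin> closed_segment u v"
  shows "view_angle q u v > 0 \<longleftrightarrow> Im ((v - q) * cnj (u - q)) > 0"
    and "view_angle q u v \<ge> 0 \<longleftrightarrow> Im ((v - q) * cnj (u - q)) \<ge> 0"
proof -
  have uq: "u \<noteq> q" using assms by auto
  have eq: "(v - q) / (u - q) = (v - q) * cnj (u - q) / of_real ((norm (u - q))\<^sup>2)"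
    by (rule complex_div_cnj)
  have "Im ((v - q) / (u - q)) = Im ((v - q) * cnj (u - q)) / (norm (u - q))\<^sup>2"
    unfolding eq Im_divide_of_real ..
  moreover have "(norm (u - q))\<^sup>2 > 0" using uq by simp
  ultimately have sign: "Im ((v - q) / (u - q)) > 0 \<longleftrightarrow> Im ((v - q) * cnj (u - q)) > 0"
    "Im ((v - q) / (u - q)) \<ge> 0 \<longleftrightarrow> Im ((v - q) * cnj (u - q)) \<ge> 0"
    by (simp_all add: zero_less_divide_iff zero_le_divide_iff)
  have angle: "view_angle q u v = Arg ((v - q) / (u - q))" using assms by (simp add: view_angle_def)
  have "Arg ((v - q) / (u - q)) \<noteq> pi"
    using ratio_notin_nonpos_Reals[OF assms] by (auto simp: Arg_eq_pi complex_nonpos_Reals_iff)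
  then have "Arg ((v - q) / (u - q)) < pi" using Arg_le_pi[of "(v - q) / (u - q)"] by linarith
  then show "view_angle q u v > 0 \<longleftrightarrow> Im ((v - q) * cnj (u - q)) > 0"
    unfolding angle sign(1)[symmetric] using Arg_lt_pi[of "(v - q) / (u - q)"] by blast
  show "view_angle q u v \<ge> 0 \<longleftrightarrow> Im ((v - q) * cnj (u - q)) \<ge> 0"
    unfolding angle sign(2)[symmetric] by (rule Arg_less_0)
qed

lemma mem_segment_coordinates:
  "z \<in> closed_segment (Complex a b) (Complex c d) \<longleftrightarrow>
    (\<exists>t. 0 \<le> t \<and> t \<le> 1 \<and> Re z = (1 - t) * a + t * c \<and> Im z = (1 - t) * b + t * d)"
  by (auto simp: closed_segment_def complex_eq_iff)

text \<open>
  The vertices are \<open>0\<close>, \<open>x - \<i>\<close>, \<open>k + \<i>\<close> and \<open>\<i>\<close>, where the last two coincide if \<open>k = 0\<close>. The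
  long side from \<open>x - \<i>\<close> to \<open>k + \<i>\<close> crosses the real axis at \<open>(x + k) / 2\<close>, and \<open>x\<close> is chosen to
  make this \<open>m + 1/2\<close>: the interior contains exactly the lattice points \<open>1, \<dots>, m\<close>, and the
  boundary contains \<open>0\<close>, \<open>x - \<i>\<close> and the \<open>k + 1\<close> lattice points of the top side. For
  \<open>x < 0\<close> the angle at 0 is reflex.
\<close>

locale slanted_polygon =
  fixes k m :: nat
begin

definition x :: real where "x = 2 * real m + 1 - real k"

definition vs :: "complex list" where
  "vs = [Complex 0 0, Complex x (- 1), Complex k 1] @ (if k = 0 then [] else [Complex 0 1])"

definition S0 where "S0 = closed_segment (Complex 0 0) (Complex x (- 1))"
definition S1 where "S1 = closed_segment (Complex x (- 1)) (Complex k 1)"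
definition S2 where "S2 = closed_segment (Complex k 1) (Complex 0 1)"
definition S3 where "S3 = closed_segment (Complex 0 1) (Complex 0 0)"

lemma xk: "x + real k = 2 * real m + 1" by (simp add: x_def)

lemma S0: "z \<in> S0 \<longleftrightarrow> - 1 \<le> Im z \<and> Im z \<le> 0 \<and> Re z = - x * Im z"
  unfolding S0_def mem_segment_coordinates by (auto intro!: exI[of _ "- Im z"])

lemma S1: "z \<in> S1 \<longleftrightarrow> - 1 \<le> Im z \<and> Im z \<le> 1 \<and> 2 * Re z = x + k + (k - x) * Im z"
proof
  assume "z \<in> S1"
  then obtain t where t: "0 \<le> t" "t \<le> 1" "Re z = (1 - t) * x + t * k" "Im z = 2 * t - 1"
    unfolding S1_def mem_segment_coordinates by auto
  show "- 1 \<le> Im z \<and> Im z \<le> 1 \<and> 2 * Re z = x + k + (k - x) * Im z"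
    using t(1,2) unfolding t(3,4) by (simp add: algebra_simps)
next
  assume "- 1 \<le> Im z \<and> Im z \<le> 1 \<and> 2 * Re z = x + k + (k - x) * Im z"
  then show "z \<in> S1"
    unfolding S1_def mem_segment_coordinates
    by (auto intro!: exI[of _ "(1 + Im z) / 2"] simp: field_simps)
qed

lemma S2: "z \<in> S2 \<longleftrightarrow> Im z = 1 \<and> 0 \<le> Re z \<and> Re z \<le> k"
proof
  assume "z \<in> S2"
  then show "Im z = 1 \<and> 0 \<le> Re z \<and> Re z \<le> k"
    unfolding S2_def mem_segment_coordinates by (auto simp: mult_left_le_one_le)
next
  assume *: "Im z = 1 \<and> 0 \<le> Re z \<and> Re z \<le> k"
  then show "z \<in> S2"
  proof (cases "k = 0")
    case True
    then show ?thesis using * unfolding S2_def mem_segment_coordinates by (auto intro!: exI[of _ 0])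
  next
    case False
    then show ?thesis using * unfolding S2_def mem_segment_coordinates
      by (auto intro!: exI[of _ "1 - Re z / k"] simp: field_simps)
  qed
qed

lemma S3: "z \<in> S3 \<longleftrightarrow> Re z = 0 \<and> 0 \<le> Im z \<and> Im z \<le> 1"
  unfolding S3_def mem_segment_coordinates by (auto intro!: exI[of _ "1 - Im z"])

lemma S0_S1: "z \<in> S0 \<Longrightarrow> z \<in> S1 \<Longrightarrow> z = Complex x (- 1)"
proof -
  assume z: "z \<in> S0" "z \<in> S1"
  then have "(x + k) * (Im z + 1) = 0" unfolding S0 S1 by (auto simp: algebra_simps)
  then have "Im z = - 1" unfolding xk by (auto simp: add_eq_0_iff2)
  then show ?thesis using z(1) unfolding S0 by (simp add: complex_eq_iff)
qed

lemma S1_S2: "z \<in> S1 \<Longrightarrow> z \<in> S2 \<Longrightarrow> z = Complex k 1"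
  unfolding S1 S2 by (simp add: complex_eq_iff)

lemma S2_S3: "z \<in> S2 \<Longrightarrow> z \<in> S3 \<Longrightarrow> z = Complex 0 1"
  unfolding S2 S3 by (simp add: complex_eq_iff)

lemma S0_S3: "z \<in> S0 \<Longrightarrow> z \<in> S3 \<Longrightarrow> z = Complex 0 0"
  unfolding S0 S3 by (simp add: complex_eq_iff)

lemma S0_S2: "z \<in> S0 \<Longrightarrow> z \<in> S2 \<Longrightarrow> False"
  unfolding S0 S2 by simp

lemma S1_S3: "z \<in> S1 \<Longrightarrow> z \<in> S3 \<Longrightarrow> k = 0 \<and> z = Complex 0 1"
proof -
  assume z: "z \<in> S1" "z \<in> S3"
  have "(x + k) * (1 - Im z) + 2 * k * Im z = 0"
    using z unfolding S1 S3 by (auto simp: algebra_simps)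
  moreover have "(x + k) * (1 - Im z) \<ge> 0" "2 * k * Im z \<ge> 0"
    using z unfolding S3 xk by auto
  ultimately have "(x + k) * (1 - Im z) = 0" "2 * k * Im z = 0" by linarith+
  then have "Im z = 1" "k = 0" unfolding xk by auto
  then show ?thesis using z unfolding S3 by (simp add: complex_eq_iff)
qed

lemma length_vs: "length vs = (if k = 0 then 3 else 4)" by (simp add: vs_def)

lemma vertices:
  "vertex vs 0 = Complex 0 0" "vertex vs (Suc 0) = Complex x (- 1)" "vertex vs (Suc (Suc 0)) = Complex k 1"
  "k = 0 \<Longrightarrow> vertex vs (Suc (Suc (Suc 0))) = Complex 0 0"
  "k > 0 \<Longrightarrow> vertex vs (Suc (Suc (Suc 0))) = Complex 0 1"
  "k > 0 \<Longrightarrow> vertex vs (Suc (Suc (Suc (Suc 0)))) = Complex 0 0"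
  unfolding vertex_def vs_def by auto

lemma sides:
  "closed_segment (vertex vs 0) (vertex vs (Suc 0)) = S0"
  "closed_segment (vertex vs (Suc 0)) (vertex vs (Suc (Suc 0))) = S1"
  by (simp_all only: vertices S0_def S1_def)

lemma sides_triangle:
  assumes "k = 0"
  shows "closed_segment (vertex vs (Suc (Suc 0))) (vertex vs (Suc (Suc (Suc 0)))) = S3"
  unfolding vertices(3) vertices(4)[OF assms] S3_def by (simp add: assms)

lemma sides_quadrilateral:
  assumes "k > 0"
  shows "closed_segment (vertex vs (Suc (Suc 0))) (vertex vs (Suc (Suc (Suc 0)))) = S2"
    "closed_segment (vertex vs (Suc (Suc (Suc 0)))) (vertex vs (Suc (Suc (Suc (Suc 0))))) = S3"
  unfolding vertices(3) vertices(5,6)[OF assms] S2_def S3_def by (rule refl)+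

lemma simple: "simple_path (closed_polygonal_path vs)"
proof (cases "k = 0")
  case True
  have len: "length vs = 3" using True unfolding length_vs by simp
  note v = vertices(1-3) vertices(4)[OF True] and s = sides sides_triangle[OF True]
  show ?thesis
    unfolding simple_closed_polygonal_path_iff[of vs, unfolded len, OF order_refl]
  proof (intro conjI allI impI)
    fix i :: nat assume "i < 3"
    then consider "i = 0" | "i = Suc 0" | "i = Suc (Suc 0)" by linarith
    then show "vertex vs i \<noteq> vertex vs (Suc i)"
      by cases (simp_all only: v, simp_all)
  next
    fix i j z assume ij: "i < j" "j < 3" and z: "z \<in> closed_segment (vertex vs i) (vertex vs (Suc i))"
      "z \<in> closed_segment (vertex vs j) (vertex vs (Suc j))"
    then consider "i = 0" "j = Suc 0" | "i = 0" "j = Suc (Suc 0)" | "i = Suc 0" "j = Suc (Suc 0)" by linarith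
    then show "(j = Suc i \<and> z = vertex vs j) \<or> (i = 0 \<and> j = 3 - 1 \<and> z = vertex vs 0)"
    proof cases
      case 1
      show ?thesis using z S0_S1[of z] unfolding 1 unfolding s unfolding v by simp
    next
      case 2
      show ?thesis using z S0_S3[of z] unfolding 2 unfolding s unfolding v by simp
    next
      case 3
      show ?thesis using z S1_S3[of z] unfolding 3 unfolding s unfolding v by auto
    qed
  qed
next
  case False
  then have k: "k > 0" by simp
  have len: "length vs = 4" using k unfolding length_vs by simp
  have "3 \<le> (4::nat)" by simp
  note v = vertices(1-3) vertices(5,6)[OF k] and s = sides sides_quadrilateral[OF k]
  show ?thesis
    unfolding simple_closed_polygonal_path_iff[of vs, unfolded len, OF \<open>3 \<le> (4::nat)\<close>]
  proof (intro conjI allI impI)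
    fix i :: nat assume "i < 4"
    then consider "i = 0" | "i = Suc 0" | "i = Suc (Suc 0)" | "i = Suc (Suc (Suc 0))" by linarith
    then show "vertex vs i \<noteq> vertex vs (Suc i)"
      by cases (simp_all only: v, use k in simp_all)
  next
    fix i j z assume ij: "i < j" "j < 4" and z: "z \<in> closed_segment (vertex vs i) (vertex vs (Suc i))"
      "z \<in> closed_segment (vertex vs j) (vertex vs (Suc j))"
    then consider "i = 0" "j = Suc 0" | "i = 0" "j = Suc (Suc 0)" | "i = 0" "j = Suc (Suc (Suc 0))"
      | "i = Suc 0" "j = Suc (Suc 0)" | "i = Suc 0" "j = Suc (Suc (Suc 0))"
      | "i = Suc (Suc 0)" "j = Suc (Suc (Suc 0))" by linarith
    then show "(j = Suc i \<and> z = vertex vs j) \<or> (i = 0 \<and> j = 4 - 1 \<and> z = vertex vs 0)"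
    proof cases
      case 1
      show ?thesis using z S0_S1[of z] unfolding 1 unfolding s unfolding v by simp
    next
      case 2
      show ?thesis using z S0_S2[of z] unfolding 2 unfolding s unfolding v by blast
    next
      case 3
      show ?thesis using z S0_S3[of z] unfolding 3 unfolding s unfolding v by simp
    next
      case 4
      show ?thesis using z S1_S2[of z] unfolding 4 unfolding s unfolding v by simp
    next
      case 5
      show ?thesis using z S1_S3[of z] k unfolding 5 unfolding s unfolding v by simp
    next
      case 6
      show ?thesis using z S2_S3[of z] unfolding 6 unfolding s unfolding v by simp
    qed
  qed
qed

lemma image: "path_image (closed_polygonal_path vs) = S0 \<union> S1 \<union> S2 \<union> S3"
proof -
  have 3: "length vs \<ge> 3" by (simp add: length_vs)
  show ?thesis
  proof (cases "k = 0")
    case True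
    then have "{..<length vs} = {0, Suc 0, Suc (Suc 0)}" unfolding length_vs by auto
    moreover have "S2 \<subseteq> S3" using True unfolding subset_iff S2 S3 by auto
    ultimately show ?thesis
      unfolding closed_polygonal_path_basics(3)[OF 3]
      by (simp only: UN_insert sides sides_triangle[OF True]) blast
  next
    case False
    then have k: "k > 0" by simp
    have "{..<length vs} = {0, Suc 0, Suc (Suc 0), Suc (Suc (Suc 0))}"
      using k unfolding length_vs by auto
    then show ?thesis
      unfolding closed_polygonal_path_basics(3)[OF 3]
      by (simp only: UN_insert sides sides_quadrilateral[OF k]) blast
  qed
qed

abbreviation G where "G \<equiv> S0 \<union> S1 \<union> S2 \<union> S3"

lemma boundary_lattice_points:
  "G \<inter> lattice_points = {Complex 0 0, Complex x (- 1)} \<union> (\<lambda>j. Complex (real j) 1) ` {..k}"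
proof (intro equalityI subsetI)
  fix z assume "z \<in> G \<inter> lattice_points"
  then have z: "z \<in> G" and "Re z \<in> \<int>" "Im z \<in> \<int>" by (auto simp: lattice_points_def)
  then obtain a b where ab: "Re z = of_int a" "Im z = of_int b" by (auto elim!: Ints_cases)
  have "- 1 \<le> real_of_int b" "real_of_int b \<le> 1" using z unfolding Un_iff S0 S1 S2 S3 ab by auto
  then have "- 1 \<le> b" "b \<le> 1" by linarith+
  then consider "b = - 1" | "b = 0" | "b = 1" by linarith
  then show "z \<in> {Complex 0 0, Complex x (- 1)} \<union> (\<lambda>j. Complex (real j) 1) ` {..k}"
  proof cases
    case 1
    then have "Re z = x" using z ab unfolding Un_iff S0 S1 S2 S3 by auto
    then show ?thesis using ab 1 by (simp add: complex_eq_iff)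
  next
    case 2
    then have "Re z = 0 \<or> 2 * Re z = 2 * real m + 1"
      using z ab unfolding Un_iff S0 S1 S2 S3 xk by auto
    moreover have "2 * Re z \<noteq> 2 * real m + 1"
    proof
      assume "2 * Re z = 2 * real m + 1"
      then have "real_of_int (2 * a) = real_of_int (2 * int m + 1)" unfolding ab by simp
      then have "2 * a = 2 * int m + 1" by linarith
      then show False by presburger
    qed
    ultimately show ?thesis using ab 2 by (simp add: complex_eq_iff)
  next
    case 3
    then have "0 \<le> Re z \<and> Re z \<le> k" using z ab unfolding Un_iff S0 S1 S2 S3 by auto
    then have "0 \<le> a" "a \<le> int k" unfolding ab by linarith+
    then have "z = Complex (real (nat a)) 1" "nat a \<le> k" using ab 3 by (auto simp: complex_eq_iff)
    then show ?thesis by blast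
  qed
next
  fix z assume "z \<in> {Complex 0 0, Complex x (- 1)} \<union> (\<lambda>j. Complex (real j) 1) ` {..k}"
  then show "z \<in> G \<inter> lattice_points"
    by (auto simp: S0 S1 S2 S3 lattice_points_def x_def)
qed

lemma card_boundary_lattice_points: "card (G \<inter> lattice_points) = k + 3"
proof -
  have "inj (\<lambda>j. Complex (real j) 1)" by (auto simp: inj_def)
  then have "card ((\<lambda>j. Complex (real j) 1) ` {..k}) = k + 1"
    by (subst card_image) (auto intro: inj_on_subset)
  moreover have "card {Complex 0 0, Complex x (- 1)} = 2" by simp
  moreover have "{Complex 0 0, Complex x (- 1)} \<inter> (\<lambda>j. Complex (real j) 1) ` {..k} = {}" by auto
  ultimately show ?thesis unfolding boundary_lattice_points by (subst card_Un_disjoint) auto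
qed

text \<open>
  Going around the polygon, every side is seen from the point under a nonnegative angle, and some
  under a positive one; so the winding number does not vanish.
\<close>

lemma interior_lattice_point:
  assumes "1 \<le> j" "j \<le> m"
  shows "Complex (real j) 0 \<in> inside G"
proof (rule ccontr)
  let ?q = "Complex (real j) 0"
  assume "?q \<notin> inside G"
  have jm: "1 \<le> real j" "real j \<le> real m" using assms by auto
  have "?q \<notin> G" unfolding Un_iff S0 S1 S2 S3 xk using jm by auto
  then have off: "?q \<notin> S0" "?q \<notin> S1" "?q \<notin> S2" "?q \<notin> S3" by auto
  have 3: "length vs \<ge> 3" by (simp add: length_vs)
  have "?q \<in> outside (path_image (closed_polygonal_path vs))"
    using \<open>?q \<notin> G\<close> \<open>?q \<notin> inside G\<close> inside_Un_outside[of G] unfolding image by blast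
  then have "winding_number (closed_polygonal_path vs) ?q = 0"
    using closed_polygonal_path_basics(1)[OF 3] simple
    by (intro winding_number_zero_in_outside) (simp_all add: simple_path_imp_path)
  then have "(\<Sum>i<length vs. view_angle ?q (vertex vs i) (vertex vs (Suc i))) = 0"
    using winding_number_closed_polygonal_path[OF 3, of ?q] \<open>?q \<notin> G\<close> unfolding image by simp
  moreover have p0: "view_angle ?q (Complex 0 0) (Complex x (- 1)) > 0"
    by (subst view_angle_cross(1)) (use off jm in \<open>auto simp: S0_def\<close>)
  moreover have p1: "view_angle ?q (Complex x (- 1)) (Complex k 1) > 0"
  proof (subst view_angle_cross(1))
    have "2 * real j < x + k" using jm xk by linarith
    then show "Im ((Complex k 1 - ?q) * cnj (Complex x (- 1) - ?q)) > 0" by (simp add: algebra_simps)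
  qed (use off in \<open>simp add: S1_def\<close>)
  moreover have p2: "view_angle ?q (Complex k 1) (Complex 0 1) \<ge> 0"
    by (subst view_angle_cross(2)) (use off jm in \<open>auto simp: S2_def\<close>)
  moreover have p3: "view_angle ?q (Complex 0 1) (Complex 0 0) > 0"
    by (subst view_angle_cross(1)) (use off jm in \<open>auto simp: S3_def\<close>)
  moreover have "(\<Sum>i<length vs. view_angle ?q (vertex vs i) (vertex vs (Suc i))) > 0"
  proof (cases "k = 0")
    case True
    then have "{..<length vs} = {0, Suc 0, Suc (Suc 0)}" unfolding length_vs by auto
    moreover have "view_angle ?q (Complex k 1) (Complex 0 0) > 0" using p3 True by simp
    ultimately show ?thesis using p0 p1
      by (simp add: vertices(1-3) vertices(4)[OF True] del: One_nat_def)
  next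
    case False
    then have k: "k > 0" by simp
    have "{..<length vs} = {0, Suc 0, Suc (Suc 0), Suc (Suc (Suc 0))}"
      using k unfolding length_vs by auto
    then show ?thesis using p0 p1 p2 p3 by (simp add: vertices(1-3) vertices(5,6)[OF k])
  qed
  ultimately show False by linarith
qed

text \<open>
  Every other lattice point off the boundary can escape to infinity along a vertical or horizontal
  ray that avoids the boundary.
\<close>

lemma interior_lattice_points:
  "inside G \<inter> lattice_points = (\<lambda>j. Complex (real j) 0) ` {1..m}"
proof (intro equalityI subsetI)
  fix z assume "z \<in> inside G \<inter> lattice_points"
  then have inside: "z \<in> inside G" and "Re z \<in> \<int>" "Im z \<in> \<int>" by (auto simp: lattice_points_def)
  then obtain a b where ab: "Re z = of_int a" "Im z = of_int b" by (auto elim!: Ints_cases)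
  have z: "z \<notin> G" and not_outside: "z \<notin> outside G"
    using inside inside_no_overlap[of G] inside_Int_outside[of G] by blast+
  have ray: False if "d \<noteq> 0" "\<And>t. t > 0 \<Longrightarrow> z + of_real t * d \<notin> G" for d
  proof -
    have "z + of_real t * d \<notin> G" if "t \<ge> 0" for t
      using z \<open>\<And>t. t > 0 \<Longrightarrow> z + of_real t * d \<notin> G\<close>[of t] that by (cases "t = 0") auto
    then show False using ray_outside[OF that(1), of z G] not_outside by blast
  qed
  have "b = 0"
  proof (rule ccontr)
    assume "b \<noteq> 0"
    then consider "b \<ge> 1" | "b \<le> - 1" by linarith
    then show False
    proof cases
      case 1
      then have "Im z \<ge> 1" unfolding ab by simp
      then show False by (intro ray[of \<i>]) (auto simp: S0 S1 S2 S3)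
    next
      case 2
      then have "Im z \<le> - 1" unfolding ab by linarith
      then show False by (intro ray[of "- \<i>"]) (auto simp: S0 S1 S2 S3)
    qed
  qed
  then have Im0: "Im z = 0" using ab by simp
  have "1 \<le> a \<and> a \<le> int m"
  proof (rule ccontr)
    assume "\<not> (1 \<le> a \<and> a \<le> int m)"
    moreover have "a \<noteq> 0" using z Im0 ab by (auto simp: S0)
    ultimately consider "a \<le> - 1" | "a \<ge> int m + 1" by linarith
    then show False
    proof cases
      case 1
      then have "Re z \<le> - 1" unfolding ab by linarith
      then show False using Im0 xk by (intro ray[of "- 1"]) (auto simp: S0 S1 S2 S3)
    next
      case 2
      then have "Re z \<ge> real m + 1" unfolding ab by linarith
      then show False using Im0 xk by (intro ray[of 1]) (auto simp: S0 S1 S2 S3)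
    qed
  qed
  then have "z = Complex (real (nat a)) 0" "nat a \<in> {1..m}" using ab Im0 by (auto simp: complex_eq_iff)
  then show "z \<in> (\<lambda>j. Complex (real j) 0) ` {1..m}" by blast
next
  fix z assume "z \<in> (\<lambda>j. Complex (real j) 0) ` {1..m}"
  then show "z \<in> inside G \<inter> lattice_points"
    using interior_lattice_point by (auto simp: lattice_points_def)
qed

lemma card_interior_lattice_points: "card (inside G \<inter> lattice_points) = m"
  unfolding interior_lattice_points by (subst card_image) (auto simp: inj_on_def)

lemma polygon_vertices: "polygon_vertices (G \<union> inside G) vs"
  using simple image by (auto simp: polygon_vertices_def length_vs vs_def lattice_points_def x_def)

end

theorem proposition4p3:
  fixes a b c :: real
  assumes "(a, b, c) \<in> triples"
  shows "(\<exists>P. lattice_polygon P \<and>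
            (a, b, c) = (polygon_area P, real (boundary_count P) / 2, rotation_number P))
         \<longleftrightarrow> c = 1 \<and> a + 1 \<ge> b \<and> b \<ge> 3 / 2"
proof
  assume "\<exists>P. lattice_polygon P \<and>
            (a, b, c) = (polygon_area P, real (boundary_count P) / 2, rotation_number P)"
  then obtain P where P: "lattice_polygon P" "a = polygon_area P"
      "b = real (boundary_count P) / 2" "c = rotation_number P" by auto
  have "a = real (card (interior P \<inter> lattice_points)) + b - 1"
    using pick_theorem(1)[OF P(1)] P(2,3) by simp
  moreover have "real (boundary_count P) \<ge> 3" using pick_theorem(2)[OF P(1)] by simp
  ultimately show "c = 1 \<and> a + 1 \<ge> b \<and> b \<ge> 3 / 2"
    using P lattice_polygon_rotation_number[OF P(1)] by simp
next
  assume abc: "c = 1 \<and> a + 1 \<ge> b \<and> b \<ge> 3 / 2"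
  have "2 * b \<in> \<int>" "a + b \<in> \<int>" using assms by (auto simp: triples_def)
  then obtain i j where i: "2 * b = of_int i" and j: "a + b = of_int j" by (auto elim!: Ints_cases)
  define k where "k = nat (i - 3)"
  define m where "m = nat (j + 1 - i)"
  have "real_of_int i \<ge> 3" using abc i by linarith
  then have k: "real k = 2 * b - 3" by (simp add: k_def i)
  have "real_of_int (j + 1 - i) \<ge> 0" using abc i j by simp
  then have m: "real m = a - b + 1" using i j by (simp add: m_def)
  interpret slanted_polygon k m .
  define P where "P = G \<union> inside G"
  have vs: "polygon_vertices P vs" using polygon_vertices by (simp add: P_def)
  then have P: "lattice_polygon P" by (auto simp: lattice_polygon_def)
  have "boundary_count P = k + 3"
    using card_boundary_lattice_points by (simp add: boundary_count_def polygon_region(1)[OF vs] image)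
  moreover have "card (interior P \<inter> lattice_points) = m"
    using card_interior_lattice_points by (simp add: polygon_region(2)[OF vs] image)
  ultimately have "polygon_area P = a" "real (boundary_count P) / 2 = b"
    using pick_theorem(1)[OF P] k m by (simp_all add: field_simps)
  then show "\<exists>P. lattice_polygon P \<and>
            (a, b, c) = (polygon_area P, real (boundary_count P) / 2, rotation_number P)"
    using P lattice_polygon_rotation_number[OF P] abc by auto
qed

end
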